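(* Let $(X,W)$ be a bivariate stationary Gaussian random field on $\mathbb R$ with matrix covariance function $K=(K_{k\ell})_{1\le k,\ell\le2}$, let $\beta\in\mathbb R$, and let $Y(s)=X(s)\beta+W(s)$. Suppose that for some $L>0$, $K_{11}$ and $K_{22}$ satisfy conditions $\mathrm A(L,c_{11},\alpha_{11})$ and $\mathrm A(L,c_{22},\alpha_{22})$ (defined in the context) with $\alpha_{11}<\alpha_{22}+1$, and that either $X$ is independent of $W$, or $K_{12}$ satisfies $\mathrm A(L,c_{12},\alpha_{12})$ with $\alpha_{12}>\alpha_{11}$. Then the slope $\beta$ is consistently estimable on the paths of $(X,Y)$: if $p$ is an integer with $\alpha_{11}<2p$ and $h=L/n$, then the ordinary least squares estimator regressing $p$-th order differences of $Y$ on those of $X$ over the regular grid $0,h,\dots,nh=L$, $$\frac{\sum_{j=0}^{n-p}\nabla_h^{(p)}X(hj)\,\nabla_h^{(p)}Y(hj)}{\sum_{j=0}^{n-p}\{\nabla_h^{(p)}X(hj)\}^2},$$ converges to $\beta$ in probability as $n\to\infty$.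
   Context: Condition $\mathrm A(L,c,\alpha)$: a (cross-)covariance function $K$ on $\mathbb R$ can be written $K(t)=A(t)+B(t)$, where $A$ is an even analytic function and $B$ is even and continuous on $[-L,L]$; the $k$-th derivative $B^{(k)}$ on $(0,L]$ ($k=0,1,2,\dots$, $B^{(0)}=B$) satisfies, as $t\downarrow0$, $B^{(k)}(t)=(\alpha)_k\,c\,t^{\alpha-k}+o(t^{\alpha-k})$, where $c$ is a constant (non-zero when $K$ is a covariance function), $\alpha>0$ is not an even integer, and $(\alpha)_k=\Gamma(\alpha+1)/\Gamma(\alpha+1-k)$. Index $1$ refers to $X$, index $2$ to $W$: $K_{11},K_{22}$ are the covariance functions of $X,W$ and $K_{12}$ is their cross-covariance function. Differences: $\nabla_h^{(0)}Z=Z$, $\nabla_h^{(1)}Z(s)=h^{-1}\{Z(s+h)-Z(s)\}$, $\nabla_h^{(i)}Z=\nabla_h^{(1)}(\nabla_h^{(i-1)}Z)$. $W$ is not observed. *)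

theory Defs
  imports "HOL-Probability.Probability"
begin

section \<open>Stationary Gaussian random fields on the line\<close>

text \<open>Degenerate (almost surely constant) variables count as normal.\<close>

definition normal_rv :: "'a measure \<Rightarrow> ('a \<Rightarrow> real) \<Rightarrow> bool" where
  "normal_rv M Z \<longleftrightarrow> Z \<in> borel_measurable M \<and>
     ((\<exists>\<mu> \<sigma>. \<sigma> > 0 \<and> distributed M lborel Z (\<lambda>x. ennreal (normal_density \<mu> \<sigma> x))) \<or>
      (\<exists>\<mu>. AE \<omega> in M. Z \<omega> = \<mu>))"

definition gaussian_field :: "'a measure \<Rightarrow> (real \<Rightarrow> 'a \<Rightarrow> real ^ 'n) \<Rightarrow> bool" where
  "gaussian_field M Z \<longleftrightarrow>
     (\<forall>F a. finite F \<longrightarrow> normal_rv M (\<lambda>\<omega>. \<Sum>s\<in>F. a s \<bullet> Z s \<omega>))"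

definition covar :: "'a measure \<Rightarrow> ('a \<Rightarrow> real) \<Rightarrow> ('a \<Rightarrow> real) \<Rightarrow> real" where
  "covar M U V =
     integral\<^sup>L M (\<lambda>\<omega>. (U \<omega> - integral\<^sup>L M U) * (V \<omega> - integral\<^sup>L M V))"

text \<open>
  The mean is constant but need not be zero. The entry \<open>K t $ k $ l\<close> is the
  (cross-)covariance at lag \<open>t\<close> of the components \<open>k\<close> and \<open>l\<close>.
\<close>

definition stationary_gaussian_field ::
    "'a measure \<Rightarrow> (real \<Rightarrow> 'a \<Rightarrow> real ^ 'n) \<Rightarrow> (real \<Rightarrow> real ^ 'n ^ 'n) \<Rightarrow> bool" where
  "stationary_gaussian_field M Z K \<longleftrightarrow>
     gaussian_field M Z \<and>
     (\<forall>k s s'. integral\<^sup>L M (\<lambda>\<omega>. Z s \<omega> $ k) = integral\<^sup>L M (\<lambda>\<omega>. Z s' \<omega> $ k)) \<and>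
     (\<forall>k l s t. covar M (\<lambda>\<omega>. Z (s + t) \<omega> $ k) (\<lambda>\<omega>. Z s \<omega> $ l) = K t $ k $ l)"

definition independent_processes ::
    "'a measure \<Rightarrow> (real \<Rightarrow> 'a \<Rightarrow> real) \<Rightarrow> (real \<Rightarrow> 'a \<Rightarrow> real) \<Rightarrow> bool" where
  "independent_processes M X W \<longleftrightarrow>
     prob_space.indep_var M
       (Pi\<^sub>M UNIV (\<lambda>_. borel)) (\<lambda>\<omega> s. X s \<omega>)
       (Pi\<^sub>M UNIV (\<lambda>_. borel)) (\<lambda>\<omega> s. W s \<omega>)"


section \<open>Behaviour of a covariance function at the origin\<close>

definition real_analytic :: "(real \<Rightarrow> real) \<Rightarrow> bool" where
  "real_analytic f \<longleftrightarrow> (\<forall>x. \<exists>F. (\<lambda>t. f (x + t)) has_fps_expansion F)"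

text \<open>
  At the poles of the denominator, that is for \<open>\<alpha>\<close> a natural number and \<open>k > \<alpha>\<close>, the
  convention \<open>Gamma = 0\<close> at poles and \<open>x / 0 = 0\<close> gives \<open>0\<close>, the value of the falling
  factorial \<open>\<alpha> (\<alpha> - 1) \<dots> (\<alpha> - k + 1)\<close>.
\<close>

definition ffact :: "real \<Rightarrow> nat \<Rightarrow> real" where
  "ffact \<alpha> k = Gamma (\<alpha> + 1) / Gamma (\<alpha> + 1 - real k)"

text \<open>
  \<open>D k\<close> is the \<open>k\<close>-th derivative of \<open>B\<close> on \<open>{0<..L}\<close>, one-sided at \<open>L\<close>. The requirement
  \<open>c \<noteq> 0\<close>, which concerns covariance but not cross-covariance functions, is not included.
\<close>

definition condition_A :: "(real \<Rightarrow> real) \<Rightarrow> real \<Rightarrow> real \<Rightarrow> real \<Rightarrow> bool" where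
  "condition_A K L c \<alpha> \<longleftrightarrow>
     \<alpha> > 0 \<and> (\<forall>m::nat. \<alpha> \<noteq> 2 * real m) \<and>
     (\<exists>A B. (\<forall>t. K t = A t + B t) \<and>
        real_analytic A \<and> (\<forall>t. A (- t) = A t) \<and>
        continuous_on {-L..L} B \<and> (\<forall>t\<in>{-L..L}. B (- t) = B t) \<and>
        (\<exists>D :: nat \<Rightarrow> real \<Rightarrow> real.
           (\<forall>t\<in>{0<..L}. D 0 t = B t) \<and>
           (\<forall>k. \<forall>t\<in>{0<..L}. (D k has_real_derivative D (Suc k) t) (at t within {0<..L})) \<and>
           (\<forall>k. (\<lambda>t. D k t - ffact \<alpha> k * c * t powr (\<alpha> - real k))
                  \<in> o[at_right 0](\<lambda>t. t powr (\<alpha> - real k)))))"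


section \<open>Regression of differences\<close>

text \<open>The \<open>p\<close>-th order difference is the iterate \<open>nabla h ^^ p\<close>.\<close>

definition nabla :: "real \<Rightarrow> (real \<Rightarrow> real) \<Rightarrow> real \<Rightarrow> real" where
  "nabla h z s = (z (s + h) - z s) / h"

text \<open>
  Only \<open>p \<le> n\<close> is meaningful; the values at the finitely many \<open>n < p\<close> are irrelevant for
  the limit.
\<close>

definition ols_slope :: "nat \<Rightarrow> real \<Rightarrow> nat \<Rightarrow> (real \<Rightarrow> real) \<Rightarrow> (real \<Rightarrow> real) \<Rightarrow> real" where
  "ols_slope p h n x y =
     (\<Sum>j=0..n-p. (nabla h ^^ p) x (h * real j) * (nabla h ^^ p) y (h * real j)) /
     (\<Sum>j=0..n-p. ((nabla h ^^ p) x (h * real j))\<^sup>2)"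

text \<open>Measurability is part of the definition because \<open>measure\<close> vanishes on non-measurable sets.\<close>

definition tendsto_in_prob :: "'a measure \<Rightarrow> (nat \<Rightarrow> 'a \<Rightarrow> real) \<Rightarrow> real \<Rightarrow> bool" where
  "tendsto_in_prob M T l \<longleftrightarrow>
     (\<forall>n. T n \<in> borel_measurable M) \<and>
     (\<forall>\<epsilon>>0. (\<lambda>n. measure M {\<omega> \<in> space M. \<bar>T n \<omega> - l\<bar> > \<epsilon>}) \<longlonglongrightarrow> 0)"

text \<open>
  Some sequence of functionals of the observed path of \<open>(X, Y)\<close> on \<open>S\<close>, where
  \<open>Y = X \<beta> + W\<close>, converges in probability to \<open>\<beta>\<close> whatever the value of \<open>\<beta>\<close>. The
  functionals do not depend on \<open>\<beta>\<close> and do not see \<open>W\<close>.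
\<close>

definition slope_consistently_estimable ::
    "'a measure \<Rightarrow> real set \<Rightarrow> (real \<Rightarrow> 'a \<Rightarrow> real) \<Rightarrow> (real \<Rightarrow> 'a \<Rightarrow> real) \<Rightarrow> bool" where
  "slope_consistently_estimable M S X W \<longleftrightarrow>
     (\<exists>T :: nat \<Rightarrow> (real \<Rightarrow> real \<times> real) \<Rightarrow> real.
        (\<forall>n. T n \<in> borel_measurable (Pi\<^sub>M S (\<lambda>_. borel))) \<and>
        (\<forall>\<beta>. tendsto_in_prob M
               (\<lambda>n \<omega>. T n (\<lambda>s\<in>S. (X s \<omega>, X s \<omega> * \<beta> + W s \<omega>))) \<beta>))"

end

theory Submission
  imports Defs
begin

text \<open>
  The covariances of the differences \<open>\<nabla>\<^sup>p\<close> of two components at lag \<open>m h\<close> are, up to sign,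
  \<open>2 p\<close>-th differences of the covariance function \<open>K\<close>. At lag \<open>0\<close> the variance of
  \<open>\<nabla>\<^sup>p X\<close> is of exact order \<open>h powr (\<alpha>11 - 2 p)\<close>. At lag \<open>m h\<close> they are of order at most
  \<open>((m + 1) h) powr (a - 2 p)\<close> for all \<open>a \<le> \<alpha>\<close> with \<open>a \<le> 2 p\<close>. By Isserlis' formula the variance
  of a sum of products of Gaussian differences is a double sum of products of two such
  covariances. After division by the square of the expected denominator it tends to \<open>0\<close> both
  for the denominator \<open>\<Sum> (\<nabla>\<^sup>p X)\<^sup>2\<close> and, since \<open>\<alpha>11 < \<alpha>22 + 1\<close>, for \<open>\<Sum> \<nabla>\<^sup>p X \<nabla>\<^sup>p W\<close>; the mean of the
  latter is negligible because \<open>\<alpha>12 > \<alpha>11\<close>.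
\<close>

section \<open>Iterated differences\<close>

text \<open>After the division the double sum reduces to a lag sum of order \<open>(\<Sum>m<n. (m h)
  powr (e - 4 p)) / (n h powr (2 \<alpha>11 - 4 p))\<close>, where \<open>e\<close> adds up the
  exponents of two covariances: \<open>2 \<alpha>11\<close> for the denominator,
  \<open>\<alpha>11 + \<alpha>22\<close> and \<open>2 \<alpha>12\<close> for the numerator. If the
  series in \<open>m\<close> converges, short lags dominate and the order is
  \<open>n powr (2 \<alpha>11 - e - 1)\<close>; this is the origin of \<alpha>11 < \<alpha>22 + 1.
  If it diverges, long lags dominate and the order is \<open>n powr (2 \<alpha>11 - 4 p)\<close>, up
  to a logarithm in the borderline case; this decays because \<alpha>11 < 2 p. The same inequality
  lets the singular part of the covariance of X, whose difference blows up, outweigh the analytic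
  part, whose difference stays bounded.

  The obstacle in the exact order at lag 0 is that its coefficient, a difference of order 2 p of
  \<open>\<bar>x\<bar> powr \<alpha>\<close>, is an alternating sum without an evident sign; its
  zeros in \<alpha> are counted instead. Gaussianity enters through fourth moments of linear
  combinations; no joint density is used.\<close>

lemma nabla_funpow_Suc:
  "(nabla h ^^ Suc q) f x = ((nabla h ^^ q) f (x + h) - (nabla h ^^ q) f x) / h"
  by (simp add: nabla_def)

lemma nabla_funpow_add:
  "(nabla h ^^ q) (\<lambda>x. f x + g x) = (\<lambda>x. (nabla h ^^ q) f x + (nabla h ^^ q) g x)"
proof (induction q)
  case (Suc q)
  then show ?case by (auto simp: nabla_def add_divide_distrib diff_divide_distrib)
qed simp

lemma nabla_funpow_cmult:
  "(nabla h ^^ q) (\<lambda>x. c * f x) = (\<lambda>x. c * (nabla h ^^ q) f x)"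
proof (induction q)
  case (Suc q)
  then show ?case by (auto simp: nabla_def algebra_simps diff_divide_distrib)
qed simp

lemma nabla_funpow_shift:
  "(nabla h ^^ q) (\<lambda>x. f (x + c)) x = (nabla h ^^ q) f (x + c)"
proof (induction q arbitrary: x)
  case (Suc q)
  show ?case using Suc[of x] Suc[of "x + h"] by (simp add: nabla_def add_ac)
qed simp

lemma nabla_funpow_scale:
  "(nabla h ^^ q) f (x * h) = (nabla 1 ^^ q) (\<lambda>u. f (u * h)) x / h ^ q"
proof (induction q arbitrary: x)
  case (Suc q)
  have "x * h + h = (x + 1) * h" by (simp add: algebra_simps)
  then show ?case using Suc[of x] Suc[of "x + 1"]
    by (simp add: nabla_funpow_Suc diff_divide_distrib mult.commute[of h] del: funpow.simps(2))
qed simp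

lemma nabla_funpow_cong:
  assumes "\<And>k. k \<le> q \<Longrightarrow> f (x + real k * h) = g (x + real k * h)"
  shows "(nabla h ^^ q) f x = (nabla h ^^ q) g x"
  using assms
proof (induction q arbitrary: x)
  case 0
  from "0.prems"[of 0] show ?case by simp
next
  case (Suc q)
  have "(nabla h ^^ q) f x = (nabla h ^^ q) g x"
    by (rule Suc.IH) (use Suc.prems in auto)
  moreover have "(nabla h ^^ q) f (x + h) = (nabla h ^^ q) g (x + h)"
  proof (rule Suc.IH)
    fix k assume "k \<le> q"
    then have "f (x + real (Suc k) * h) = g (x + real (Suc k) * h)"
      by (intro Suc.prems) auto
    then show "f (x + h + real k * h) = g (x + h + real k * h)"
      by (simp add: algebra_simps)
  qed
  ultimately show ?case by (simp add: nabla_funpow_Suc del: funpow.simps(2))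
qed

text \<open>The induction step is Pascal's rule. The explicit weights are needed to read the leading
  coefficient as a function of the exponent.\<close>

lemma nabla_funpow_expand:
  "(nabla 1 ^^ q) f x = (\<Sum>k\<le>q. (-1) ^ (q - k) * real (q choose k) * f (x + real k))"
proof (induction q arbitrary: x)
  case (Suc q)
  let ?c = "\<lambda>k. (-1) ^ (Suc q - k) * real (q choose k) * f (x + real k)"
  have 1: "(\<Sum>k\<le>q. (-1) ^ (q - k) * real (q choose k) * f (x + real k)) = - (\<Sum>k\<le>q. ?c k)"
    unfolding sum_negf[symmetric] by (intro sum.cong refl) (auto simp: Suc_diff_le)
  have "(\<Sum>k\<le>Suc q. (-1) ^ (Suc q - k) * real (Suc q choose k) * f (x + real k)) =
      (-1) ^ Suc q * f x + (\<Sum>k\<le>q. (-1) ^ (q - k) * real (Suc q choose Suc k) * f (x + real (Suc k)))"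
    by (subst sum.atMost_Suc_shift) simp
  also have "\<dots> = ((-1) ^ Suc q * f x + (\<Sum>k\<le>q. ?c (Suc k))) +
      (\<Sum>k\<le>q. (-1) ^ (q - k) * real (q choose k) * f (x + real (Suc k)))"
    by (simp add: sum.distrib algebra_simps flip: sum.distrib)
  also have "(-1) ^ Suc q * f x + (\<Sum>k\<le>q. ?c (Suc k)) = (\<Sum>k\<le>Suc q. ?c k)"
    by (subst sum.atMost_Suc_shift) simp
  also have "\<dots> = (\<Sum>k\<le>q. ?c k)"
    by simp
  finally show ?case
    using 1 Suc[of x] Suc[of "x + 1"]
    by (simp add: nabla_funpow_Suc add_ac del: power_Suc binomial_Suc_Suc funpow.simps(2))
qed simp

text \<open>Each differencing costs at most a factor 2 / h. This crude bound serves the small lags,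
  where the points of the difference surround the origin and the derivatives of the singular part
  are out of reach.\<close>

lemma abs_nabla_funpow_le:
  assumes "0 < h"
    and "\<And>k. k \<le> q \<Longrightarrow> \<bar>f (x + real k * h)\<bar> \<le> C"
  shows "\<bar>(nabla h ^^ q) f x\<bar> \<le> (2 / h) ^ q * C"
  using assms(2)
proof (induction q arbitrary: x)
  case 0
  from "0.prems"[of 0] show ?case by simp
next
  case (Suc q)
  have "\<bar>(nabla h ^^ q) f x\<bar> \<le> (2 / h) ^ q * C"
    by (rule Suc.IH) (use Suc.prems in auto)
  moreover have "\<bar>(nabla h ^^ q) f (x + h)\<bar> \<le> (2 / h) ^ q * C"
  proof (rule Suc.IH)
    fix k assume "k \<le> q"
    then have "\<bar>f (x + real (Suc k) * h)\<bar> \<le> C"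
      by (intro Suc.prems) auto
    then show "\<bar>f (x + h + real k * h)\<bar> \<le> C"
      by (simp add: algebra_simps)
  qed
  ultimately have "\<bar>(nabla h ^^ q) f (x + h) - (nabla h ^^ q) f x\<bar> \<le> 2 * ((2 / h) ^ q * C)"
    by linarith
  then have "\<bar>(nabla h ^^ q) f (x + h) - (nabla h ^^ q) f x\<bar> / h \<le> 2 * ((2 / h) ^ q * C) / h"
    using assms(1) by (intro divide_right_mono) auto
  then show ?case using assms(1) by (simp add: nabla_funpow_Suc del: funpow.simps(2))
qed

text \<open>Differencing commutes with differentiation, so \<open>nabla h (D k)\<close> is again a
  chain of derivatives, on an interval shorter by \<open>h\<close>. The mean value inequality bounds
  its last member by \<open>C\<close>, trading one derivative for one difference. Derivatives are
  taken within the interval, so that its right end may be \<open>L\<close>.\<close>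

lemma abs_nabla_funpow_le_deriv:
  assumes "0 < h"
    and "\<And>k t. k < q \<Longrightarrow> t \<in> {x..x + real q * h} \<Longrightarrow>
           (D k has_real_derivative D (Suc k) t) (at t within {x..x + real q * h})"
    and "\<And>t. t \<in> {x..x + real q * h} \<Longrightarrow> \<bar>D q t\<bar> \<le> C"
  shows "\<bar>(nabla h ^^ q) (D 0) x\<bar> \<le> C"
  using assms(2,3)
proof (induction q arbitrary: D)
  case 0
  then show ?case by simp
next
  case (Suc q)
  let ?S = "{x..x + real (Suc q) * h}" and ?S' = "{x..x + real q * h}"
  have sub: "?S' \<subseteq> ?S" "(\<lambda>t. t + h) ` ?S' \<subseteq> ?S"
    using assms(1) by (auto simp: algebra_simps)
  have "\<bar>(nabla h ^^ q) (nabla h (D 0)) x\<bar> \<le> C"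
  proof (rule Suc.IH[of "\<lambda>k. nabla h (D k)"])
    fix k t assume k: "k < q" and t: "t \<in> ?S'"
    have "(D k has_real_derivative D (Suc k) t) (at t within ?S')"
      using sub t by (intro DERIV_subset[OF Suc.prems(1)]) (use k in auto)
    moreover have "(D k has_real_derivative D (Suc k) (t + h)) (at (t + h) within (\<lambda>t. t + h) ` ?S')"
      using sub t by (intro DERIV_subset[OF Suc.prems(1)]) (use k in auto)
    then have "(D k \<circ> (\<lambda>t. t + h) has_real_derivative D (Suc k) (t + h) * 1) (at t within ?S')"
      by (intro DERIV_image_chain) (auto intro!: derivative_eq_intros)
    ultimately show "(nabla h (D k) has_real_derivative nabla h (D (Suc k)) t) (at t within ?S')"
      unfolding nabla_def o_def using assms(1)
      by (auto intro!: derivative_eq_intros)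
  next
    fix t assume t: "t \<in> ?S'"
    have "norm (D q (t + h) - D q t) \<le> C * norm (t + h - t)"
      by (rule field_differentiable_bound[of ?S "D q" "D (Suc q)"])
         (use Suc.prems t sub in auto)
    then show "\<bar>nabla h (D q) t\<bar> \<le> C"
      using assms(1) by (simp add: nabla_def field_simps)
  qed
  then show ?case by (simp add: funpow_swap1)
qed

lemma nabla_funpow_tendsto:
  assumes "\<And>x. (\<lambda>n. f n x) \<longlonglongrightarrow> g x"
  shows "(\<lambda>n. (nabla h ^^ q) (f n) x) \<longlonglongrightarrow> (nabla h ^^ q) g x"
proof (induction q arbitrary: x)
  case (Suc q)
  then show ?case
    by (simp add: nabla_funpow_Suc divide_inverse tendsto_intros del: funpow.simps(2))
qed (use assms in simp)

text \<open>The \<open>q\<close>-th derivative of the power vanishes identically, so the derivative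
  bound holds with constant 0.\<close>

lemma nabla_funpow_pow_eq_0:
  assumes "j < q" "0 < h"
  shows "(nabla h ^^ q) (\<lambda>x. x ^ j) x = 0"
proof -
  let ?P = "monom (1::real) j"
  have 0: "(pderiv ^^ q) ?P = 0"
  proof -
    have "degree ((pderiv ^^ k) ?P) = j - k" for k
      by (induction k) (auto simp: degree_pderiv degree_monom_eq)
    then have "degree ((pderiv ^^ j) ?P) = 0" by simp
    then have "pderiv ((pderiv ^^ j) ?P) = 0"
      using pderiv_eq_0_iff by blast
    then have "(pderiv ^^ Suc j) ?P = 0" by simp
    moreover have "(pderiv ^^ k) 0 = (0 :: real poly)" for k by (induction k) auto
    ultimately show ?thesis
      using assms(1) funpow_add[of "q - Suc j" "Suc j" "pderiv :: real poly \<Rightarrow> _"] by (simp del: funpow.simps)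
  qed
  have "\<bar>(nabla h ^^ q) (\<lambda>x. poly ((pderiv ^^ 0) ?P) x) x\<bar> \<le> 0"
    by (rule abs_nabla_funpow_le_deriv[OF assms(2), where D = "\<lambda>k x. poly ((pderiv ^^ k) ?P) x"])
       (use 0 in \<open>auto intro: has_field_derivative_at_within poly_DERIV\<close>)
  then show ?thesis by (simp add: poly_monom)
qed

section \<open>The leading coefficient of the variance of a difference\<close>

text \<open>The clause that each zero lies below a point of \<open>Z\<close> carries the induction:
  the zero found between \<open>Max Z\<close> and the new point exceeds \<open>Max Z\<close>, hence
  differs from all earlier ones.\<close>

lemma Rolle_zeros:
  fixes f f' :: "real \<Rightarrow> real"
  assumes "\<And>x. (f has_real_derivative f' x) (at x)" "finite Z" "\<And>z. z \<in> Z \<Longrightarrow> f z = 0"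
  shows "\<exists>Z'. finite Z' \<and> card Z' = card Z - 1 \<and> (\<forall>z\<in>Z'. f' z = 0 \<and> (\<exists>y\<in>Z. z < y))"
  using assms(2,3)
proof (induction Z rule: finite_linorder_max_induct)
  case empty
  then show ?case by auto
next
  case (insert z Z)
  show ?case
  proof (cases "Z = {}")
    case True
    then show ?thesis by (intro exI[of _ "{}"]) auto
  next
    case False
    obtain Z' where Z': "finite Z'" "card Z' = card Z - 1" "\<forall>z\<in>Z'. f' z = 0 \<and> (\<exists>y\<in>Z. z < y)"
      using insert by auto
    let ?m = "Max Z"
    have m: "?m \<in> Z" "?m < z" using False insert.hyps by auto
    obtain \<xi> where \<xi>: "?m < \<xi>" "\<xi> < z" "f z - f ?m = (z - ?m) * f' \<xi>"
      using MVT2[OF m(2), of f f'] assms(1) by auto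
    have "f' \<xi> = 0" using \<xi> m insert.prems by auto
    moreover have "\<xi> \<notin> Z'"
      using Z'(3) \<xi>(1) insert.hyps(1) by (meson Max_ge leD less_trans order.strict_trans2)
    moreover have "card Z > 0" using False insert.hyps(1) by (simp add: card_gt_0_iff)
    moreover have "z \<notin> Z" using insert.hyps by auto
    ultimately show ?thesis
      using Z' \<xi> insert.hyps(1)
      by (intro exI[of _ "insert \<xi> Z'"]) auto
  qed
qed

text \<open>Dividing by one exponential turns its term into a constant, which differentiation
  removes; Rolle's theorem loses one zero while the sum loses one term. The remaining coefficients
  are only multiplied by the nonzero differences of frequencies.\<close>

lemma exponential_sum_zeros:
  fixes c u :: "'i \<Rightarrow> real"
  assumes "finite S" "inj_on c S" "finite Z" "card S \<le> card Z"
    and "\<And>z. z \<in> Z \<Longrightarrow> (\<Sum>k\<in>S. u k * exp (c k * z)) = 0"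
  shows "\<forall>k\<in>S. u k = 0"
  using assms
proof (induction S arbitrary: c u Z rule: finite_induct)
  case empty
  then show ?case by simp
next
  case (insert s S)
  let ?f = "\<lambda>z. u s + (\<Sum>k\<in>S. u k * exp ((c k - c s) * z))"
  let ?f' = "\<lambda>z. \<Sum>k\<in>S. (u k * (c k - c s)) * exp ((c k - c s) * z)"
  have f0: "?f z = 0" if "z \<in> Z" for z
  proof -
    have "(\<Sum>k\<in>insert s S. u k * exp (c k * z)) = exp (c s * z) * ?f z"
      using insert.hyps by (simp add: sum_distrib_left distrib_left left_diff_distrib exp_diff)
    then show ?thesis using insert.prems(4)[OF that] by simp
  qed
  have "(?f has_real_derivative ?f' z) (at z)" for z
    by (auto intro!: derivative_eq_intros sum.cong)
  from Rolle_zeros[OF this insert.prems(2) f0]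
  obtain Z' where Z': "finite Z'" "card Z' = card Z - 1" "\<forall>z\<in>Z'. ?f' z = 0" by blast
  have "\<forall>k\<in>S. u k * (c k - c s) = 0"
  proof (rule insert.IH[of "\<lambda>k. c k - c s" Z'])
    show "inj_on (\<lambda>k. c k - c s) S" using insert.prems(1) by (auto simp: inj_on_def)
    show "card S \<le> card Z'" using Z' insert.prems(3) insert.hyps by simp
  qed (use Z' in auto)
  then have S0: "\<forall>k\<in>S. u k = 0"
    using insert.prems(1) insert.hyps by (auto simp: inj_on_def)
  have "Z \<noteq> {}" using insert.prems(3) insert.hyps by auto
  then have "u s = 0" using f0 S0 by fastforce
  then show ?case using S0 by auto
qed

text \<open>
  As a function of \<open>\<alpha>\<close> the difference is, up to a constant, an exponential sum with the \<open>p\<close>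
  frequencies \<open>ln 1, \<dots>, ln p\<close>. It vanishes at the \<open>p - 1\<close> points \<open>2, 4, \<dots>, 2p - 2\<close>, where
  the power is a polynomial of degree below \<open>2 p\<close>, hence nowhere else.
\<close>

lemma nabla_funpow_abs_powr_nonzero:
  assumes "0 < \<alpha>" "\<alpha> < 2 * real p" "\<And>m::nat. \<alpha> \<noteq> 2 * real m"
  shows "(nabla 1 ^^ (2 * p)) (\<lambda>x. \<bar>x\<bar> powr \<alpha>) (- real p) \<noteq> 0"
proof
  assume zero: "(nabla 1 ^^ (2 * p)) (\<lambda>x. \<bar>x\<bar> powr \<alpha>) (- real p) = 0"
  define w where "w k = (-1) ^ (2 * p - k) * real (2 * p choose k)" for k
  \<comment> \<open>The points \<open>p + k\<close> and \<open>p - k\<close> of the expansion are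
    both at distance \<open>k\<close> from the centre, so their weights merge; the centre itself
    contributes \<open>0 powr z = 0\<close>.\<close>
  define u where "u k = w (p + k) + w (p - k)" for k
  have p: "p > 0" using assms by auto
  have eq: "(nabla 1 ^^ (2 * p)) (\<lambda>x. \<bar>x\<bar> powr z) (- real p) =
      (\<Sum>k\<in>{1..p}. u k * exp (ln (real k) * z))" if "z > 0" for z
  proof -
    have "(nabla 1 ^^ (2 * p)) (\<lambda>x. \<bar>x\<bar> powr z) (- real p) =
        (\<Sum>k\<in>{..2*p}. w k * \<bar>real k - real p\<bar> powr z)"
      by (simp add: nabla_funpow_expand w_def)
    also have "{..2*p} = {..<p} \<union> {p} \<union> {p<..2*p}" by auto
    also have "(\<Sum>k\<in>\<dots>. w k * \<bar>real k - real p\<bar> powr z) =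
       (\<Sum>k\<in>{..<p}. w k * \<bar>real k - real p\<bar> powr z) + (\<Sum>k\<in>{p<..2*p}. w k * \<bar>real k - real p\<bar> powr z)"
      using that by (subst sum.union_disjoint, simp, simp, force)+ simp
    also have "(\<Sum>k\<in>{..<p}. w k * \<bar>real k - real p\<bar> powr z) = (\<Sum>k\<in>{1..p}. w (p - k) * real k powr z)"
      by (rule sum.reindex_bij_witness[of _ "\<lambda>k. p - k" "\<lambda>k. p - k"]) auto
    also have "(\<Sum>k\<in>{p<..2*p}. w k * \<bar>real k - real p\<bar> powr z) = (\<Sum>k\<in>{1..p}. w (p + k) * real k powr z)"
      by (rule sum.reindex_bij_witness[of _ "\<lambda>k. p + k" "\<lambda>k. k - p"]) auto
    finally have "(nabla 1 ^^ (2 * p)) (\<lambda>x. \<bar>x\<bar> powr z) (- real p) =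
        (\<Sum>k\<in>{1..p}. u k * real k powr z)"
      by (simp add: u_def distrib_right add.commute flip: sum.distrib)
    also have "\<dots> = (\<Sum>k\<in>{1..p}. u k * exp (ln (real k) * z))"
      by (intro sum.cong) (auto simp: powr_def mult.commute)
    finally show ?thesis .
  qed
  let ?Z = "insert \<alpha> ((\<lambda>i. 2 * real i) ` {1..<p})"
  have "\<forall>k\<in>{1..p}. u k = 0"
  proof (rule exponential_sum_zeros[of "{1..p}" "\<lambda>k. ln (real k)" ?Z])
    show "card {1..p} \<le> card ?Z"
      using assms(3) by (subst card_insert_disjoint) (auto simp: card_image inj_on_def)
    fix z assume "z \<in> ?Z"
    then consider "z = \<alpha>" | i where "i \<in> {1..<p}" "z = 2 * real i" by auto
    then show "(\<Sum>k\<in>{1..p}. u k * exp (ln (real k) * z)) = 0"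
    proof cases
      case 1
      then show ?thesis using zero eq[of \<alpha>] assms by simp
    next
      case 2
      have "\<bar>x\<bar> powr z = x ^ (2 * i)" for x :: real
      proof (cases "x = 0")
        case False
        then have "\<bar>x\<bar> powr real (2 * i) = \<bar>x\<bar> ^ (2 * i)" by (intro powr_realpow) auto
        then show ?thesis using 2 by (simp add: power_even_abs)
      qed (use 2 in auto)
      then have "(nabla 1 ^^ (2 * p)) (\<lambda>x. \<bar>x\<bar> powr z) (- real p) = 0"
        using 2 by (simp add: nabla_funpow_pow_eq_0)
      then show ?thesis using eq[of z] 2 by simp
    qed
  qed (auto simp: inj_on_def)
  \<comment> \<open>The contradiction is at the outermost points:
    \<open>w (2 * p) + w 0 = 2\<close>.\<close>
  then have "u p = 0" using p by auto
  then show False by (simp add: u_def w_def)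
qed

section \<open>Differences of a covariance function\<close>

text \<open>A local power series may be differentiated termwise. The translations by
  \<open>x\<close> arise because \<open>has_fps_expansion\<close> speaks of expansions at 0.\<close>

lemma real_analytic_deriv:
  assumes "real_analytic f"
  shows "(f has_real_derivative deriv f x) (at x)" and "real_analytic (deriv f)"
proof -
  have diff: "f field_differentiable at x" for x
  proof -
    obtain F where F: "(\<lambda>t. f (x + t)) has_fps_expansion F"
      using assms by (auto simp: real_analytic_def)
    then have ev: "eventually (\<lambda>t. eval_fps F t = f (x + t)) (nhds 0)"
      and "fps_conv_radius F > 0" by (simp_all add: has_fps_expansion_def)
    then have "(eval_fps F has_field_derivative eval_fps (fps_deriv F) 0) (at 0)"
      by (intro has_field_derivative_eval_fps) (simp add: in_eball_iff zero_ereal_def)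
    then have "((\<lambda>t. f (x + t)) has_field_derivative eval_fps (fps_deriv F) 0) (at 0)"
      using DERIV_cong_ev[OF refl ev refl] by simp
    then have "(f has_field_derivative eval_fps (fps_deriv F) 0) (at x)"
      using DERIV_shift[of f "eval_fps (fps_deriv F) 0" 0 x] by (simp add: add.commute)
    then show ?thesis unfolding field_differentiable_def by blast
  qed
  then show deriv: "(f has_real_derivative deriv f x) (at x)" for x
    using field_differentiable_derivI by blast
  show "real_analytic (deriv f)"
    unfolding real_analytic_def
  proof
    fix x
    obtain F where "(\<lambda>t. f (x + t)) has_fps_expansion F"
      using assms by (auto simp: real_analytic_def)
    then have "deriv (\<lambda>t. f (x + t)) has_fps_expansion fps_deriv F"
      by (rule has_fps_expansion_deriv)
    moreover have "deriv (\<lambda>t. f (x + t)) = (\<lambda>t. deriv f (x + t))"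
    proof (rule ext, rule DERIV_imp_deriv)
      show "((\<lambda>t. f (x + t)) has_real_derivative deriv f (x + t)) (at t)" for t
        using deriv[of "x + t"] DERIV_shift[of f "deriv f (x + t)" t x] by (simp add: add.commute)
    qed
    ultimately show "\<exists>F. (\<lambda>t. deriv f (x + t)) has_fps_expansion F" by auto
  qed
qed

text \<open>The \<open>q\<close>-th derivative is continuous, hence bounded on the compact interval.
  What matters is that \<open>C\<close> depends neither on \<open>h\<close> nor on
  \<open>x\<close>.\<close>

lemma nabla_real_analytic_bounded:
  assumes "real_analytic f"
  shows "\<exists>C\<ge>0. \<forall>h x. 0 < h \<longrightarrow> -L \<le> x \<longrightarrow> x + real q * h \<le> L \<longrightarrow> \<bar>(nabla h ^^ q) f x\<bar> \<le> C"
proof -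
  have an: "real_analytic ((deriv ^^ k) f)" for k
    by (induction k) (simp_all add: assms real_analytic_deriv(2))
  have der: "((deriv ^^ k) f has_real_derivative (deriv ^^ Suc k) f t) (at t)" for k t
    unfolding funpow.simps o_def by (rule real_analytic_deriv(1)[OF an])
  have "continuous_on {-L..L} ((deriv ^^ q) f)"
    by (intro continuous_at_imp_continuous_on ballI DERIV_isCont[OF der])
  then have "bounded ((deriv ^^ q) f ` {-L..L})"
    by (intro compact_imp_bounded compact_continuous_image) auto
  then obtain C where C: "\<forall>t\<in>{-L..L}. \<bar>(deriv ^^ q) f t\<bar> \<le> C"
    unfolding bounded_iff by auto
  show ?thesis
  proof (intro exI[of _ "max 0 C"] conjI allI impI)
    fix h x :: real
    assume h: "0 < h" and x: "-L \<le> x" "x + real q * h \<le> L"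
    have "\<bar>(nabla h ^^ q) ((deriv ^^ 0) f) x\<bar> \<le> max 0 C"
    proof (rule abs_nabla_funpow_le_deriv[OF h, where D = "\<lambda>k. (deriv ^^ k) f"])
      fix t assume "t \<in> {x..x + real q * h}"
      then have "t \<in> {-L..L}" using x by auto
      with C show "\<bar>(deriv ^^ q) f t\<bar> \<le> max 0 C" by (simp add: max.coboundedI2)
    qed (rule has_field_derivative_at_within[OF der])
    then show "\<bar>(nabla h ^^ q) f x\<bar> \<le> max 0 C" by simp
  qed auto
qed

text \<open>Near 0 the expansion gives the bound, away from 0 compactness does. An asymptotic
  statement at the origin alone would not suffice, since the lags on the grid range up to the fixed
  length \<open>L\<close>.\<close>

lemma powr_bound_from_smallo:
  fixes f :: "real \<Rightarrow> real"
  assumes cont: "continuous_on {0<..L} f"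
    and o: "(\<lambda>t. f t - \<kappa> * t powr \<gamma>) \<in> o[at_right 0](\<lambda>t. t powr \<gamma>)"
  shows "\<exists>C\<ge>0. \<forall>t\<in>{0<..L}. \<bar>f t\<bar> \<le> C * t powr \<gamma>"
proof -
  have "eventually (\<lambda>t. \<bar>f t - \<kappa> * t powr \<gamma>\<bar> \<le> 1 * \<bar>t powr \<gamma>\<bar>) (at_right 0)"
    using landau_o.smallD[OF o, of 1] by simp
  then obtain b where b: "b > 0" "\<And>t. 0 < t \<Longrightarrow> t < b \<Longrightarrow> \<bar>f t - \<kappa> * t powr \<gamma>\<bar> \<le> t powr \<gamma>"
    by (auto simp: eventually_at_right_field)
  have "continuous_on {b/2..L} (\<lambda>t. f t / t powr \<gamma>)"
    by (intro continuous_intros continuous_on_subset[OF cont]) (use b(1) in auto)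
  then have "bounded ((\<lambda>t. f t / t powr \<gamma>) ` {b/2..L})"
    by (intro compact_imp_bounded compact_continuous_image) auto
  then obtain C where C: "\<forall>t\<in>{b/2..L}. \<bar>f t / t powr \<gamma>\<bar> \<le> C"
    unfolding bounded_iff real_norm_def by blast
  have "\<bar>f t\<bar> \<le> max (1 + \<bar>\<kappa>\<bar>) C * t powr \<gamma>" if t: "t \<in> {0<..L}" for t
  proof (cases "t < b")
    case True
    have "\<bar>f t\<bar> \<le> \<bar>f t - \<kappa> * t powr \<gamma>\<bar> + \<bar>\<kappa> * t powr \<gamma>\<bar>" by linarith
    also have "\<dots> \<le> (1 + \<bar>\<kappa>\<bar>) * t powr \<gamma>"
      using b(2)[of t] t True by (simp add: abs_mult algebra_simps)
    also have "\<dots> \<le> max (1 + \<bar>\<kappa>\<bar>) C * t powr \<gamma>" by (intro mult_right_mono) auto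
    finally show ?thesis .
  next
    case False
    then have "\<bar>f t\<bar> / t powr \<gamma> \<le> C" using C[rule_format, of t] b(1) t by (simp add: abs_divide)
    then have "\<bar>f t\<bar> \<le> C * t powr \<gamma>" using t by (simp add: field_simps)
    also have "\<dots> \<le> max (1 + \<bar>\<kappa>\<bar>) C * t powr \<gamma>" by (intro mult_right_mono) auto
    finally show ?thesis .
  qed
  then show ?thesis by (intro exI[of _ "max (1 + \<bar>\<kappa>\<bar>) C"]) auto
qed

section \<open>Upper and lower bounds drawn from condition A\<close>

lemma ffact_0: "\<alpha> > 0 \<Longrightarrow> ffact \<alpha> 0 = 1"
  using Gamma_real_pos[of "\<alpha> + 1"] by (auto simp: ffact_def Gamma_eq_zero_iff elim!: nonpos_Ints_cases)

text \<open>The last clause leaves the point \<xi> open because the sign of \<alpha> - q is unknown: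
  \<xi> is a point of the interval at which the bound on the \<open>q\<close>-th derivative is
  largest, the left end for a negative exponent and the right end for a positive one.\<close>

lemma condition_A_E:
  assumes "condition_A f L c \<alpha>" "L > 0"
  obtains A B where "f = (\<lambda>t. A t + B t)" "real_analytic A"
    "(\<lambda>t. B t - c * t powr \<alpha>) \<in> o[at_right 0](\<lambda>t. t powr \<alpha>)"
    "\<forall>t\<in>{-L..L}. B (- t) = B t"
    "B 0 = 0"
    "\<exists>C\<ge>0. \<forall>t\<in>{-L..L}. \<bar>B t\<bar> \<le> C * \<bar>t\<bar> powr \<alpha>"
    "\<forall>q. \<exists>C\<ge>0. \<forall>x h. 0 < h \<longrightarrow> 0 < x \<longrightarrow> x + real q * h \<le> L \<longrightarrow>
       (\<exists>\<xi>. x \<le> \<xi> \<and> \<xi> \<le> L \<and> \<bar>(nabla h ^^ q) B x\<bar> \<le> C * \<xi> powr (\<alpha> - real q))"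
proof -
  from assms(1) obtain A B D where A: "real_analytic A" and obj:
      "\<alpha> > 0" "\<forall>t. f t = A t + B t"
      "continuous_on {-L..L} B" "\<forall>t\<in>{-L..L}. B (- t) = B t" "\<forall>t\<in>{0<..L}. D 0 t = B t"
      "\<forall>k. \<forall>t\<in>{0<..L}. (D k has_real_derivative D (Suc k) t) (at t within {0<..L})"
      "\<forall>k. (\<lambda>t. D k t - ffact \<alpha> k * c * t powr (\<alpha> - real k)) \<in> o[at_right 0](\<lambda>t. t powr (\<alpha> - real k))"
    unfolding condition_A_def by (elim conjE exE) (rule that; assumption)
  note \<alpha> = obj(1) and K = obj(2)[rule_format] and cont = obj(3) and even = obj(4)[rule_format]
    and D0 = obj(5)[rule_format] and der = obj(6)[rule_format] and o = obj(7)[rule_format]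
  have evL: "eventually (\<lambda>t. t \<in> {0<..L}) (at_right 0)"
    using \<open>L > 0\<close> by (auto simp: eventually_at_right_field intro!: exI[of _ L])
  have oB: "(\<lambda>t. B t - c * t powr \<alpha>) \<in> o[at_right 0](\<lambda>t. t powr \<alpha>)"
  proof -
    have "eventually (\<lambda>t. D 0 t - c * t powr \<alpha> = B t - c * t powr \<alpha>) (at_right 0)"
      using evL by eventually_elim (simp add: D0)
    from landau_o.small.in_cong[OF this] show ?thesis
      using o[of 0] \<alpha> by (simp add: ffact_0)
  qed
  have Dbound: "\<exists>C\<ge>0. \<forall>t\<in>{0<..L}. \<bar>D k t\<bar> \<le> C * t powr (\<alpha> - real k)" for k
  proof (rule powr_bound_from_smallo[OF _ o])
    show "continuous_on {0<..L} (D k)"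
      unfolding continuous_on_eq_continuous_within using der by (blast intro: DERIV_continuous)
  qed
  obtain C0 where C0: "C0 \<ge> 0" "\<And>t. t \<in> {0<..L} \<Longrightarrow> \<bar>B t\<bar> \<le> C0 * t powr \<alpha>"
    using Dbound[of 0] D0 by auto
  \<comment> \<open>The expansion only concerns \<open>t\<close> tending to 0 from the right;
    continuity carries the limit over to the value at 0.\<close>
  have B0: "B 0 = 0"
  proof -
    have "(B \<longlongrightarrow> B 0) (at 0 within {-L..L})"
      using cont \<open>L > 0\<close> by (auto simp: continuous_on_def)
    then have 1: "(B \<longlongrightarrow> B 0) (at_right 0)"
      using \<open>L > 0\<close> at_within_Icc_at_right[of 0 L] tendsto_within_subset[of B _ 0 "{-L..L}" "{0..L}"] by auto
    have "((\<lambda>t. C0 * t powr \<alpha>) \<longlongrightarrow> C0 * 0 powr \<alpha>) (at_right 0)"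
      using \<alpha> by (intro tendsto_intros) (auto simp: eventually_at_right_field intro!: exI[of _ 1])
    then have "((\<lambda>t. C0 * t powr \<alpha>) \<longlongrightarrow> 0) (at_right 0)" by simp
    then have "(B \<longlongrightarrow> 0) (at_right 0)"
      by (rule Lim_null_comparison[rotated]) (use evL C0 in \<open>auto elim!: eventually_mono\<close>)
    with 1 show ?thesis by (meson tendsto_unique trivial_limit_at_right_real)
  qed
  have Bb: "\<bar>B t\<bar> \<le> C0 * \<bar>t\<bar> powr \<alpha>" if "t \<in> {-L..L}" for t
  proof -
    consider "t = 0" | "t \<in> {0<..L}" | "- t \<in> {0<..L}" using \<open>t \<in> {-L..L}\<close> by force
    then show ?thesis
    proof cases
      case 3
      then show ?thesis using C0(2)[of "- t"] even[OF that] by simp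
    qed (use B0 C0 in auto)
  qed
  have nab: "\<exists>C\<ge>0. \<forall>x h. 0 < h \<longrightarrow> 0 < x \<longrightarrow> x + real q * h \<le> L \<longrightarrow>
       (\<exists>\<xi>. x \<le> \<xi> \<and> \<xi> \<le> L \<and> \<bar>(nabla h ^^ q) B x\<bar> \<le> C * \<xi> powr (\<alpha> - real q))" for q
  proof -
    obtain C where C: "C \<ge> 0" "\<And>t. t \<in> {0<..L} \<Longrightarrow> \<bar>D q t\<bar> \<le> C * t powr (\<alpha> - real q)"
      using Dbound[of q] by blast
    have "\<exists>\<xi>. x \<le> \<xi> \<and> \<xi> \<le> L \<and> \<bar>(nabla h ^^ q) B x\<bar> \<le> C * \<xi> powr (\<alpha> - real q)"
      if h: "0 < h" and x: "0 < x" "x + real q * h \<le> L" for x h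
    proof -
      let ?S = "{x..x + real q * h}"
      have S: "?S \<subseteq> {0<..L}" using x by auto
      have "\<exists>\<xi>\<in>?S. \<forall>t\<in>?S. C * t powr (\<alpha> - real q) \<le> C * \<xi> powr (\<alpha> - real q)"
        by (intro continuous_attains_sup continuous_intros) (use h x in auto)
      then obtain \<xi> where \<xi>: "\<xi> \<in> ?S" "\<And>t. t \<in> ?S \<Longrightarrow> C * t powr (\<alpha> - real q) \<le> C * \<xi> powr (\<alpha> - real q)"
        by auto
      have "\<bar>(nabla h ^^ q) (D 0) x\<bar> \<le> C * \<xi> powr (\<alpha> - real q)"
      proof (rule abs_nabla_funpow_le_deriv[OF h])
        fix k t assume "t \<in> ?S"
        then show "(D k has_real_derivative D (Suc k) t) (at t within ?S)"
          using S by (intro DERIV_subset[OF der]) auto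
      next
        fix t assume "t \<in> ?S"
        then show "\<bar>D q t\<bar> \<le> C * \<xi> powr (\<alpha> - real q)"
          using S C(2)[of t] \<xi>(2)[of t] by auto
      qed
      moreover have "(nabla h ^^ q) (D 0) x = (nabla h ^^ q) B x"
      proof (rule nabla_funpow_cong)
        fix k assume "k \<le> q"
        then have "real k * h \<le> real q * h" using h by (intro mult_right_mono) auto
        moreover have "0 \<le> real k * h" using h by auto
        ultimately show "D 0 (x + real k * h) = B (x + real k * h)"
          using x by (intro D0) auto
      qed
      ultimately show ?thesis using \<xi>(1) x by (intro exI[of _ \<xi>]) auto
    qed
    then show ?thesis using C(1) by blast
  qed
  show ?thesis
  proof (rule that[of A B])
    show "f = (\<lambda>t. A t + B t)" using K by auto
    show "\<exists>C\<ge>0. \<forall>t\<in>{-L..L}. \<bar>B t\<bar> \<le> C * \<bar>t\<bar> powr \<alpha>" using Bb C0(1) by blast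
    show "\<forall>t\<in>{-L..L}. B (- t) = B t" using even by blast
  qed (rule A oB B0 allI[OF nab])+
qed

text \<open>The points of the difference run from \<open>(m - p) h\<close> to
  \<open>(m + p) h\<close> and so are centred at lag \<open>m h\<close>; the two conditions on
  \<open>n\<close> keep them in \<open>{-L..L}\<close>. The factor \<open>m + 1\<close> in place of
  \<open>m\<close> gives a meaningful bound at lag 0.\<close>

definition lag_bound :: "(real \<Rightarrow> real) \<Rightarrow> real \<Rightarrow> nat \<Rightarrow> real \<Rightarrow> bool" where
  "lag_bound f L p a \<longleftrightarrow> (\<exists>C\<ge>0. \<forall>n m. 2 * p \<le> n \<longrightarrow> m + p \<le> n \<longrightarrow>
     \<bar>(nabla (L / real n) ^^ (2 * p)) f ((real m - real p) * (L / real n))\<bar>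
       \<le> C * (real (m + 1) * (L / real n)) powr (a - 2 * real p))"

text \<open>
  The exponent may be lowered from \<open>\<alpha>\<close> to any smaller \<open>a\<close> because the lags stay bounded; for
  \<open>a \<le> 2 p\<close> the bound then also absorbs the analytic part.
\<close>

lemma condition_A_nabla_bound:
  assumes cA: "condition_A f L c \<alpha>" and L: "L > 0" and p: "p > 0"
    and a: "a \<le> \<alpha>" "a \<le> 2 * real p"
  shows "lag_bound f L p a"
proof -
  obtain A B where f: "f = (\<lambda>t. A t + B t)" and A: "real_analytic A"
    and Bb: "\<exists>C\<ge>0. \<forall>t\<in>{-L..L}. \<bar>B t\<bar> \<le> C * \<bar>t\<bar> powr \<alpha>"
    and Bq: "\<exists>C\<ge>0. \<forall>x h. 0 < h \<longrightarrow> 0 < x \<longrightarrow> x + real (2 * p) * h \<le> L \<longrightarrow>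
       (\<exists>\<xi>. x \<le> \<xi> \<and> \<xi> \<le> L \<and> \<bar>(nabla h ^^ (2 * p)) B x\<bar> \<le> C * \<xi> powr (\<alpha> - real (2 * p)))"
    by (rule condition_A_E[OF cA L]) (rule that, assumption, assumption, assumption, erule allE, assumption)
  from cA have \<alpha>: "\<alpha> > 0" by (simp add: condition_A_def)
  obtain CA where CA: "CA \<ge> 0"
    "\<And>h x. 0 < h \<Longrightarrow> -L \<le> x \<Longrightarrow> x + real (2 * p) * h \<le> L \<Longrightarrow> \<bar>(nabla h ^^ (2 * p)) A x\<bar> \<le> CA"
    using nabla_real_analytic_bounded[OF A, of L "2 * p"] by blast
  obtain C0 where C0: "C0 \<ge> 0" "\<And>t. t \<in> {-L..L} \<Longrightarrow> \<bar>B t\<bar> \<le> C0 * \<bar>t\<bar> powr \<alpha>"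
    using Bb by auto
  obtain Cq where Cq: "Cq \<ge> 0"
    "\<And>h x. 0 < h \<Longrightarrow> 0 < x \<Longrightarrow> x + real (2 * p) * h \<le> L \<Longrightarrow>
       \<exists>\<xi>. x \<le> \<xi> \<and> \<xi> \<le> L \<and> \<bar>(nabla h ^^ (2 * p)) B x\<bar> \<le> Cq * \<xi> powr (\<alpha> - real (2 * p))"
    using Bq by blast
  define b where "b = a - 2 * real p"
  have b: "b \<le> 0" using a by (simp add: b_def)
  \<comment> \<open>\<open>R\<close> pays for replacing an argument of size at least
    \<open>y / (p + 2)\<close> by \<open>y = (m + 1) h\<close>, and \<open>E\<close> below pays for
    lowering the exponent. The three summands of \<open>C\<close> belong to the analytic part, to
    the lags with \<open>m > p\<close> and to those with \<open>m \<le> p\<close>.\<close>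
  define R where "R = (1 / (real p + 2)) powr b"
  define E where "E = L powr (\<alpha> - a)"
  define C where "C = CA / L powr b + (Cq * E * R + C0 * 2 ^ (2 * p) * (2 * real p) powr \<alpha> * E * R)"
  \<comment> \<open>Split off \<open>t powr (\<alpha> - a)\<close>, which is at most
    \<open>E\<close> because \<open>t \<le> L\<close>. The remaining power has exponent
    \<open>b \<le> 0\<close> and is decreasing, so the lower bound on \<open>t\<close> controls
    it.\<close>
  have powr_bound: "t powr (\<alpha> - 2 * real p) \<le> E * R * y powr b"
    if "0 < y" "y / (real p + 2) \<le> t" "t \<le> L" for t y
  proof -
    have t: "t > 0" using divide_pos_pos[OF that(1), of "real p + 2"] that(2) by linarith
    have "t powr (\<alpha> - 2 * real p) = t powr (\<alpha> - a) * t powr b"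
      by (simp add: b_def flip: powr_add)
    also have "\<dots> \<le> L powr (\<alpha> - a) * (1 / (real p + 2) * y) powr b"
      using that t a b by (intro mult_mono powr_mono2 powr_mono2') (auto intro!: mult_pos_pos)
    also have "\<dots> = E * R * y powr b"
      unfolding E_def R_def using \<open>0 < y\<close> by (subst powr_mult) auto
    finally show ?thesis .
  qed
  have main: "\<bar>(nabla h ^^ (2 * p)) f x\<bar> \<le> C * y powr b"
    if n: "2 * p \<le> n" and m: "m + p \<le> n" and h: "h = L / real n"
      and x: "x = (real m - real p) * h" and y: "y = real (m + 1) * h" for n m h x y
  proof -
    have n0: "n > 0" using n p by auto
    have h0: "h > 0" using h L n0 by auto
    have nh: "real n * h = L" using h n0 by auto
    have y0: "y > 0" using y h0 by auto
    have le: "real i * h \<le> L" if "i \<le> n" for i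
      unfolding nh[symmetric] using that h0 by (intro mult_right_mono) auto
    have yL: "y \<le> L" unfolding y using m p by (intro le) auto
    have xL: "x + real (2 * p) * h \<le> L" 
      using le[OF m] by (simp add: x algebra_simps)
    have xL': "-L \<le> x"
    proof -
      have "real p * h \<le> L" using le[of p] n by simp
      moreover have "0 \<le> real m * h" using h0 by simp
      ultimately show ?thesis unfolding x left_diff_distrib by linarith
    qed
    have "\<bar>(nabla h ^^ (2 * p)) A x\<bar> \<le> CA" by (rule CA(2)[OF h0 xL' xL])
    also have "\<dots> = CA / L powr b * L powr b" using L by simp
    also have "\<dots> \<le> CA / L powr b * y powr b"
      using y0 yL b CA(1) by (intro mult_left_mono powr_mono2') auto
    finally have 1: "\<bar>(nabla h ^^ (2 * p)) A x\<bar> \<le> CA / L powr b * y powr b" .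
    have 2: "\<bar>(nabla h ^^ (2 * p)) B x\<bar> \<le>
        (Cq * E * R + C0 * 2 ^ (2 * p) * (2 * real p) powr \<alpha> * E * R) * y powr b"
    proof (cases "p < m")
      case True
      have x0: "0 < x" using True h0 by (simp add: x)
      obtain \<xi> where \<xi>: "x \<le> \<xi>" "\<xi> \<le> L" "\<bar>(nabla h ^^ (2 * p)) B x\<bar> \<le> Cq * \<xi> powr (\<alpha> - real (2 * p))"
        using Cq(2)[OF h0 x0 xL] by blast
      \<comment> \<open>Here \<open>m + 1 \<le> (m - p) (p + 2)\<close>, with equality at
        \<open>m = p + 1\<close>; this is the source of \<open>p + 2\<close>.\<close>
      have "y / (real p + 2) \<le> x"
      proof -
        obtain i where i: "m = p + 1 + i" using True less_iff_Suc_add[of p m] by auto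
        have "real (m + 1) \<le> (real m - real p) * (real p + 2)"
          by (simp add: i algebra_simps)
        then have "real (m + 1) * h \<le> (real m - real p) * (real p + 2) * h"
          using h0 by (intro mult_right_mono) auto
        then show ?thesis by (simp add: x y field_simps)
      qed
      then have "\<xi> powr (\<alpha> - 2 * real p) \<le> E * R * y powr b"
        using y0 \<xi> by (intro powr_bound) auto
      then have "Cq * \<xi> powr (\<alpha> - 2 * real p) \<le> Cq * (E * R * y powr b)"
        using Cq(1) by (rule mult_left_mono)
      moreover have "0 \<le> C0 * 2 ^ (2 * p) * (2 * real p) powr \<alpha> * E * R * y powr b"
        using C0(1) by (simp add: E_def R_def)
      ultimately show ?thesis using \<xi>(3) by (simp add: algebra_simps)
    next
      \<comment> \<open>The origin now lies among the points of the difference or between them. All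
        arguments have size at most \<open>2 p h\<close>, and \<open>h\<close> itself is comparable
        to \<open>y\<close>, so bounding the values of \<open>B\<close> loses only
        constants.\<close>
      case False
      have "\<bar>(nabla h ^^ (2 * p)) B x\<bar> \<le> (2 / h) ^ (2 * p) * (C0 * (2 * real p * h) powr \<alpha>)"
      proof (rule abs_nabla_funpow_le[OF h0])
        fix k assume k: "k \<le> 2 * p"
        have eq: "x + real k * h = (real m + real k - real p) * h" by (simp add: x algebra_simps)
        have "\<bar>real m + real k - real p\<bar> \<le> 2 * real p" using k False by auto
        then have le2: "\<bar>x + real k * h\<bar> \<le> 2 * real p * h"
          unfolding eq abs_mult using h0 by (simp add: mult_right_mono)
        moreover have "2 * real p * h \<le> L" using le[OF n] by simp
        ultimately have "\<bar>B (x + real k * h)\<bar> \<le> C0 * \<bar>x + real k * h\<bar> powr \<alpha>"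
          by (intro C0(2)) auto
        also have "\<dots> \<le> C0 * (2 * real p * h) powr \<alpha>"
          using C0(1) \<alpha> le2 by (intro mult_left_mono powr_mono2) auto
        finally show "\<bar>B (x + real k * h)\<bar> \<le> C0 * (2 * real p * h) powr \<alpha>" .
      qed
      also have "(2 / h) ^ (2 * p) = 2 ^ (2 * p) * h powr (- 2 * real p)"
        using h0 powr_realpow[OF h0, of "2 * p"] by (simp add: power_divide powr_minus_divide)
      also have "\<dots> * (C0 * (2 * real p * h) powr \<alpha>) =
         C0 * 2 ^ (2 * p) * (2 * real p) powr \<alpha> * h powr (\<alpha> - 2 * real p)"
        using h0 by (simp add: powr_mult powr_diff powr_minus_divide)
      also have "\<dots> \<le> C0 * 2 ^ (2 * p) * (2 * real p) powr \<alpha> * (E * R * y powr b)"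
      proof (intro mult_left_mono powr_bound)
        show "y / (real p + 2) \<le> h" using False h0
          by (simp add: y pos_divide_le_eq mult.commute[of h])
        show "h \<le> L" using le[of 1] n0 by simp
      qed (use y0 C0(1) in auto)
      moreover have "0 \<le> Cq * E * R * y powr b"
        using Cq(1) by (simp add: E_def R_def)
      ultimately show ?thesis by (simp add: algebra_simps)
    qed
    have "\<bar>(nabla h ^^ (2 * p)) f x\<bar> \<le> \<bar>(nabla h ^^ (2 * p)) A x\<bar> + \<bar>(nabla h ^^ (2 * p)) B x\<bar>"
      by (simp add: f nabla_funpow_add)
    with 1 2 show ?thesis by (simp add: C_def algebra_simps)
  qed
  have "C \<ge> 0" using CA(1) C0(1) Cq(1) by (simp add: C_def E_def R_def)
  then show ?thesis unfolding lag_bound_def b_def[symmetric]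
    using main by (intro exI[of _ C]) simp
qed

text \<open>Multiplied by \<open>h powr (2 p - \<alpha>)\<close>, the difference of \<open>B\<close>
  with step \<open>h\<close> becomes the difference with step 1 of
  \<open>x \<mapsto> B (x h) / h powr \<alpha>\<close>. This function converges pointwise to
  \<open>c * \<bar>x\<bar> powr \<alpha>\<close>, whose difference is not 0, while the analytic part
  is scaled away.\<close>

lemma condition_A_nabla_lower_bound:
  assumes cA: "condition_A f L c \<alpha>" and L: "L > 0" and c: "c \<noteq> 0" and \<alpha>p: "\<alpha> < 2 * real p"
  shows "\<exists>\<kappa>>0. eventually (\<lambda>n. \<kappa> * (L / real n) powr (\<alpha> - 2 * real p) \<le>
     \<bar>(nabla (L / real n) ^^ (2 * p)) f (- real p * (L / real n))\<bar>) sequentially"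
proof -
  obtain A B where f: "f = (\<lambda>t. A t + B t)" and A: "real_analytic A"
    and o: "(\<lambda>t. B t - c * t powr \<alpha>) \<in> o[at_right 0](\<lambda>t. t powr \<alpha>)"
    and even: "\<forall>t\<in>{-L..L}. B (- t) = B t" and B0: "B 0 = 0"
    by (rule condition_A_E[OF cA L]) (rule that, assumption+)
  from cA have \<alpha>: "\<alpha> > 0" "\<And>m::nat. \<alpha> \<noteq> 2 * real m" by (auto simp: condition_A_def)
  define h where "h n = L / real n" for n
  have h0: "h \<longlonglongrightarrow> 0" unfolding h_def by (rule lim_const_over_n)
  have hpos: "eventually (\<lambda>n. h n > 0) sequentially"
    using eventually_gt_at_top[of 0] by eventually_elim (use L in \<open>simp add: h_def\<close>)
  obtain CA where CA: "CA \<ge> 0"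
    "\<And>h x. 0 < h \<Longrightarrow> -L \<le> x \<Longrightarrow> x + real (2 * p) * h \<le> L \<Longrightarrow> \<bar>(nabla h ^^ (2 * p)) A x\<bar> \<le> CA"
    using nabla_real_analytic_bounded[OF A, of L "2 * p"] by blast
  let ?b = "2 * real p - \<alpha>"
  have small: "eventually (\<lambda>n. r * h n \<le> L) sequentially" for r
  proof -
    have "(\<lambda>n. r * h n) \<longlonglongrightarrow> r * 0" by (intro tendsto_intros h0)
    then have "eventually (\<lambda>n. r * h n < L) sequentially"
      using L by (intro order_tendstoD) auto
    then show ?thesis by eventually_elim auto
  qed
  have hb: "(\<lambda>n. h n powr ?b) \<longlonglongrightarrow> 0"
  proof -
    have "(\<lambda>n. h n powr ?b) \<longlonglongrightarrow> 0 powr ?b"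
      using \<alpha>p by (intro tendsto_powr' h0 tendsto_const)
        (use hpos in \<open>auto elim!: eventually_mono\<close>)
    then show ?thesis by simp
  qed
  have limA: "(\<lambda>n. h n powr ?b * (nabla (h n) ^^ (2 * p)) A (- real p * h n)) \<longlonglongrightarrow> 0"
  proof (rule Lim_null_comparison)
    show "eventually (\<lambda>n. norm (h n powr ?b * (nabla (h n) ^^ (2 * p)) A (- real p * h n)) \<le> h n powr ?b * CA) sequentially"
      using hpos small[of "real p"]
    proof eventually_elim
      case (elim n)
      then have "\<bar>(nabla (h n) ^^ (2 * p)) A (- real p * h n)\<bar> \<le> CA"
        by (intro CA(2)) auto
      then show ?case by (simp add: abs_mult mult_left_mono)
    qed
    show "(\<lambda>n. h n powr ?b * CA) \<longlonglongrightarrow> 0" using tendsto_mult[OF hb tendsto_const] by simp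
  qed
  \<comment> \<open>The expansion covers \<open>x > 0\<close>; evenness on \<open>{-L..L}\<close>
    covers \<open>x < 0\<close> once \<open>\<bar>x\<bar> h \<le> L\<close>, and
    \<open>B 0 = 0\<close> covers the centre.\<close>
  have pt: "(\<lambda>n. B (x * h n) / h n powr \<alpha>) \<longlonglongrightarrow> c * \<bar>x\<bar> powr \<alpha>" for x
  proof (cases "x = 0")
    case False
    have "((\<lambda>t. (B t - c * t powr \<alpha>) / t powr \<alpha>) \<longlongrightarrow> 0) (at_right 0)"
      using o by (rule smalloD_tendsto)
    then have "((\<lambda>t. (B t - c * t powr \<alpha>) / t powr \<alpha> + c) \<longlongrightarrow> 0 + c) (at_right 0)"
      by (intro tendsto_intros)
    then have "((\<lambda>t. B t / t powr \<alpha>) \<longlongrightarrow> 0 + c) (at_right 0)"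
      by (rule Lim_transform_eventually)
         (auto simp: eventually_at_right_field field_simps intro!: exI[of _ 1])
    moreover have "filterlim (\<lambda>n. \<bar>x\<bar> * h n) (at_right 0) sequentially"
      unfolding filterlim_at
      using tendsto_mult[OF tendsto_const h0, of "\<bar>x\<bar>"] hpos False by (auto elim!: eventually_mono)
    ultimately have "(\<lambda>n. B (\<bar>x\<bar> * h n) / (\<bar>x\<bar> * h n) powr \<alpha>) \<longlonglongrightarrow> c"
      by (auto dest: filterlim_compose)
    then have "(\<lambda>n. B (\<bar>x\<bar> * h n) / (\<bar>x\<bar> * h n) powr \<alpha> * \<bar>x\<bar> powr \<alpha>) \<longlonglongrightarrow> c * \<bar>x\<bar> powr \<alpha>"
      by (intro tendsto_intros)
    then show ?thesis
    proof (rule Lim_transform_eventually)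
      show "eventually (\<lambda>n. B (\<bar>x\<bar> * h n) / (\<bar>x\<bar> * h n) powr \<alpha> * \<bar>x\<bar> powr \<alpha> =
          B (x * h n) / h n powr \<alpha>) sequentially"
        using hpos small[of "\<bar>x\<bar>"]
      proof eventually_elim
        case (elim n)
        have "B (\<bar>x\<bar> * h n) = B (x * h n)"
          using even[rule_format, of "x * h n"] elim mult_nonpos_nonneg[of x "h n"]
          by (cases "x \<ge> 0") auto
        then show ?case using False elim by (simp add: powr_mult)
      qed
    qed
  qed (use B0 in simp)
  let ?\<kappa> = "c * (nabla 1 ^^ (2 * p)) (\<lambda>x. \<bar>x\<bar> powr \<alpha>) (- real p)"
  have "(\<lambda>n. (nabla 1 ^^ (2 * p)) (\<lambda>x. B (x * h n) / h n powr \<alpha>) (- real p)) \<longlonglongrightarrow>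
      (nabla 1 ^^ (2 * p)) (\<lambda>x. c * \<bar>x\<bar> powr \<alpha>) (- real p)"
    by (intro nabla_funpow_tendsto pt)
  then have limB: "(\<lambda>n. (nabla 1 ^^ (2 * p)) (\<lambda>x. B (x * h n) / h n powr \<alpha>) (- real p)) \<longlonglongrightarrow> ?\<kappa>"
    by (simp add: nabla_funpow_cmult)
  have "(\<lambda>n. h n powr ?b * (nabla (h n) ^^ (2 * p)) B (- real p * h n)) \<longlonglongrightarrow> ?\<kappa>"
    using limB
  proof (rule Lim_transform_eventually)
    show "eventually (\<lambda>n. (nabla 1 ^^ (2 * p)) (\<lambda>x. B (x * h n) / h n powr \<alpha>) (- real p) =
        h n powr ?b * (nabla (h n) ^^ (2 * p)) B (- real p * h n)) sequentially"
      using hpos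
    proof eventually_elim
      case (elim n)
      have "h n ^ (2 * p) = h n powr (2 * real p)" 
        using powr_realpow[OF elim, of "2 * p"] by simp
      then show ?case
        using elim nabla_funpow_cmult[of "2 * p" 1 "1 / h n powr \<alpha>" "\<lambda>x. B (x * h n)"]
        unfolding nabla_funpow_scale by (simp add: powr_diff)
    qed
  qed
  from tendsto_add[OF limA this]
  have "(\<lambda>n. h n powr ?b * (nabla (h n) ^^ (2 * p)) f (- real p * h n)) \<longlonglongrightarrow> ?\<kappa>"
    by (simp add: f nabla_funpow_add distrib_left)
  then have lim: "(\<lambda>n. \<bar>h n powr ?b * (nabla (h n) ^^ (2 * p)) f (- real p * h n)\<bar>) \<longlonglongrightarrow> \<bar>?\<kappa>\<bar>"
    by (rule tendsto_rabs)
  have \<kappa>: "\<bar>?\<kappa>\<bar> > 0"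
    using c nabla_funpow_abs_powr_nonzero[OF \<alpha>(1) \<alpha>p \<alpha>(2)] by simp
  then have "eventually (\<lambda>n. \<bar>?\<kappa>\<bar> / 2 < \<bar>h n powr ?b * (nabla (h n) ^^ (2 * p)) f (- real p * h n)\<bar>) sequentially"
    by (intro order_tendstoD(1)[OF lim]) auto
  then have "eventually (\<lambda>n. \<bar>?\<kappa>\<bar> / 2 * h n powr (\<alpha> - 2 * real p) \<le>
     \<bar>(nabla (h n) ^^ (2 * p)) f (- real p * h n)\<bar>) sequentially"
    using hpos
  proof eventually_elim
    case (elim n)
    have "h n powr (\<alpha> - 2 * real p) = 1 / h n powr ?b" 
      using powr_minus_divide[of "h n" ?b] by simp
    moreover have "\<bar>?\<kappa>\<bar> / 2 < h n powr ?b * \<bar>(nabla (h n) ^^ (2 * p)) f (- real p * h n)\<bar>"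
      using elim(1) unfolding abs_mult by simp
    moreover have "h n powr ?b > 0" using elim by simp
    ultimately show ?case
      by (simp only: times_divide_eq_right mult_1_right pos_divide_le_eq mult.commute[of _ "h n powr ?b"] less_imp_le)
  qed
  then show ?thesis
    unfolding h_def by (intro exI[of _ "\<bar>?\<kappa>\<bar> / 2"] conjI half_gt_zero \<kappa>)
qed

text \<open>\<open>q\<close> plays the role of 2 p. After cancelling powers of \<open>L / n\<close>,
  the factor \<open>n powr (2 \<alpha> - e - 1)\<close> is left beside the summand. Keeping
  \<open>n powr (- \<epsilon>)\<close> of it and weakening the rest to a power of
  \<open>m + 1\<close> makes the lag series converge, which treats dominant short lags, dominant
  long lags and the logarithmic border case at once.\<close>

lemma lag_sum_negligible:
  fixes \<alpha> q e L :: real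
  assumes "\<alpha> < q" "2 * \<alpha> - 1 < e" "L > 0"
  shows "(\<lambda>n. (\<Sum>m<n. (real (m + 1) * (L / real n)) powr (e - 2 * q)) /
           (real n * ((L / real n) powr (\<alpha> - q))\<^sup>2)) \<longlonglongrightarrow> 0"
proof -
  \<comment> \<open>The second inequality gives \<open>?s < -1\<close>, so the series converges; the
    third makes \<open>2 \<alpha> - e - 1 + \<epsilon>\<close> negative, so that \<open>n\<close>
    may be replaced by the smaller \<open>m + 1\<close>.\<close>
  obtain \<epsilon> where \<epsilon>: "0 < \<epsilon>" "\<epsilon> < 2 * q - 2 * \<alpha>" "\<epsilon> < 1 + e - 2 * \<alpha>"
    using dense[of 0 "min (2 * q - 2 * \<alpha>) (1 + e - 2 * \<alpha>)"] assms by auto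
  let ?s = "2 * \<alpha> - 2 * q - 1 + \<epsilon>"
  have "summable (\<lambda>m. real m powr ?s)" using \<epsilon> by (simp add: summable_real_powr_iff)
  then have sm: "summable (\<lambda>m. real (m + 1) powr ?s)"
    using summable_iff_shift[of "\<lambda>m. real m powr ?s" 1] by simp
  let ?S = "\<Sum>m. real (m + 1) powr ?s"
  have ub: "(\<Sum>m<n. (real (m + 1) * (L / real n)) powr (e - 2 * q)) /
           (real n * ((L / real n) powr (\<alpha> - q))\<^sup>2) \<le> L powr (e - 2 * \<alpha>) * real n powr (- \<epsilon>) * ?S"
    if n: "n > 0" for n
  proof -
    have h: "L / real n > 0" using n assms by simp
    have "(\<Sum>m<n. (real (m + 1) * (L / real n)) powr (e - 2 * q)) / (real n * ((L / real n) powr (\<alpha> - q))\<^sup>2)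
       = (\<Sum>m<n. L powr (e - 2 * \<alpha>) * (real (m + 1) powr (e - 2 * q) * real n powr (2 * \<alpha> - e - 1)))"
      unfolding sum_divide_distrib
    proof (rule sum.cong[OF refl])
      fix m
      have "(real (m + 1) * (L / real n)) powr (e - 2 * q) / (real n * ((L / real n) powr (\<alpha> - q))\<^sup>2) =
         real (m + 1) powr (e - 2 * q) * ((L / real n) powr (e - 2 * q) / ((L / real n) powr (\<alpha> - q))\<^sup>2) / real n"
        using n assms by (subst powr_mult) auto
      also have "(L / real n) powr (e - 2 * q) / ((L / real n) powr (\<alpha> - q))\<^sup>2 = (L / real n) powr (e - 2 * \<alpha>)"
        using h by (simp add: power2_eq_square flip: powr_add powr_diff)
      also have "\<dots> = L powr (e - 2 * \<alpha>) * real n powr (2 * \<alpha> - e)"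
        using n assms powr_minus_divide[of "real n" "e - 2 * \<alpha>"] by (simp add: powr_divide)
      also have "real n powr (2 * \<alpha> - e) = real n powr (2 * \<alpha> - e - 1) * real n"
        using n by (simp add: powr_diff)
      finally show "(real (m + 1) * (L / real n)) powr (e - 2 * q) / (real n * ((L / real n) powr (\<alpha> - q))\<^sup>2) =
         L powr (e - 2 * \<alpha>) * (real (m + 1) powr (e - 2 * q) * real n powr (2 * \<alpha> - e - 1))"
        using n by simp
    qed
    also have "\<dots> \<le> (\<Sum>m<n. L powr (e - 2 * \<alpha>) * (real n powr (- \<epsilon>) * real (m + 1) powr ?s))"
    proof (intro sum_mono mult_left_mono)
      fix m assume "m \<in> {..<n}"
      then have m: "real (m + 1) \<le> real n" by auto
      have "real n powr (2 * \<alpha> - e - 1) = real n powr (- \<epsilon>) * real n powr (2 * \<alpha> - e - 1 + \<epsilon>)"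
        by (simp flip: powr_add)
      also have "\<dots> \<le> real n powr (- \<epsilon>) * real (m + 1) powr (2 * \<alpha> - e - 1 + \<epsilon>)"
        using m \<epsilon> by (intro mult_left_mono powr_mono2') auto
      finally have "real (m + 1) powr (e - 2 * q) * real n powr (2 * \<alpha> - e - 1) \<le>
         real (m + 1) powr (e - 2 * q) * (real n powr (- \<epsilon>) * real (m + 1) powr (2 * \<alpha> - e - 1 + \<epsilon>))"
        by (intro mult_left_mono) auto
      also have "\<dots> = real n powr (- \<epsilon>) * real (m + 1) powr ?s"
        by (simp add: mult.left_commute flip: powr_add) (simp add: algebra_simps)
      finally show "real (m + 1) powr (e - 2 * q) * real n powr (2 * \<alpha> - e - 1)
         \<le> real n powr (- \<epsilon>) * real (m + 1) powr ?s" .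
    qed auto
    also have "\<dots> = L powr (e - 2 * \<alpha>) * real n powr (- \<epsilon>) * (\<Sum>m<n. real (m + 1) powr ?s)"
      by (simp add: sum_distrib_left mult.assoc)
    also have "\<dots> \<le> L powr (e - 2 * \<alpha>) * real n powr (- \<epsilon>) * ?S"
      by (intro mult_left_mono sum_le_suminf sm) auto
    finally show ?thesis .
  qed
  have lim: "(\<lambda>n. L powr (e - 2 * \<alpha>) * real n powr (- \<epsilon>) * ?S) \<longlonglongrightarrow> 0"
    using \<epsilon>(1) by (intro tendsto_mult_left_zero tendsto_mult_right_zero tendsto_neg_powr filterlim_real_sequentially) auto
  show ?thesis
    by (rule tendsto_sandwich[OF _ _ tendsto_const lim])
       (rule always_eventually, simp add: sum_nonneg,
        rule eventually_mono[OF eventually_gt_at_top[of 0]], erule ub)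
qed

section \<open>Moments in a Gaussian space\<close>

lemma (in prob_space) normal_rv_moments:
  assumes "normal_rv M Z"
  shows "integrable M (\<lambda>\<omega>. Z \<omega> ^ 4)"
    and "expectation Z = 0 \<Longrightarrow> expectation (\<lambda>\<omega>. Z \<omega> ^ 4) = 3 * (expectation (\<lambda>\<omega>. (Z \<omega>)\<^sup>2))\<^sup>2"
proof -
  have meas [measurable]: "Z \<in> borel_measurable M" using assms by (simp add: normal_rv_def)
  have "integrable M (\<lambda>\<omega>. Z \<omega> ^ 4) \<and> (expectation Z = 0 \<longrightarrow>
      expectation (\<lambda>\<omega>. Z \<omega> ^ 4) = 3 * (expectation (\<lambda>\<omega>. (Z \<omega>)\<^sup>2))\<^sup>2)"
  proof (cases "\<exists>\<mu>. AE \<omega> in M. Z \<omega> = \<mu>")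
    case True
    then obtain \<mu> where \<mu>: "AE \<omega> in M. Z \<omega> = \<mu>" by auto
    have "expectation Z = \<mu>"
      using \<mu> by (subst integral_cong_AE[of _ _ "\<lambda>_. \<mu>"]) (auto simp: prob_space)
    moreover have "expectation (\<lambda>\<omega>. Z \<omega> ^ 4) = \<mu> ^ 4"
      using \<mu> by (subst integral_cong_AE[of _ _ "\<lambda>_. \<mu> ^ 4"]) (auto simp: prob_space)
    moreover have "expectation (\<lambda>\<omega>. (Z \<omega>)\<^sup>2) = \<mu>\<^sup>2"
      using \<mu> by (subst integral_cong_AE[of _ _ "\<lambda>_. \<mu>\<^sup>2"]) (auto simp: prob_space)
    moreover have "integrable M (\<lambda>\<omega>. Z \<omega> ^ 4)"
      using \<mu> by (subst integrable_cong_AE[of _ _ "\<lambda>_. \<mu> ^ 4"]) auto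
    ultimately show ?thesis by auto
  next
    case False
    then obtain \<mu> \<sigma> where \<sigma>: "\<sigma> > 0"
      and d: "distributed M lborel Z (\<lambda>x. ennreal (normal_density \<mu> \<sigma> x))"
      using assms by (auto simp: normal_rv_def)
    have int: "integrable M (\<lambda>\<omega>. (Z \<omega> - \<mu>) ^ k)" for k
      using integrable_normal_moment[OF \<sigma>, of \<mu> k] distributed_integrable[OF d, of "\<lambda>x. (x - \<mu>) ^ k"] \<sigma>
      by simp
    have E: "expectation (\<lambda>\<omega>. (Z \<omega> - \<mu>) ^ k) = (\<integral>x. normal_density \<mu> \<sigma> x * (x - \<mu>) ^ k \<partial>lborel)" for k
      using distributed_integral[OF d, of "\<lambda>x. (x - \<mu>) ^ k"] \<sigma> by simp
    \<comment> \<open>The normal density yields central moments; the binomial expansion about \<mu>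
      carries integrability over to the fourth power of \<open>Z\<close> itself.\<close>
    have expand: "z ^ 4 = (z - \<mu>) ^ 4 + (4 * \<mu> * (z - \<mu>) ^ 3 + (6 * \<mu>\<^sup>2 * (z - \<mu>)\<^sup>2 +
        (4 * \<mu> ^ 3 * (z - \<mu>) ^ 1 + \<mu> ^ 4)))" for z
      by (simp add: power4_eq_xxxx power3_eq_cube power2_eq_square algebra_simps)
    have "integrable M (\<lambda>\<omega>. Z \<omega> ^ 4)"
      by (subst expand) (intro Bochner_Integration.integrable_add integrable_mult_right int integrable_const)
    moreover have "expectation (\<lambda>\<omega>. Z \<omega> ^ 4) = 3 * (expectation (\<lambda>\<omega>. (Z \<omega>)\<^sup>2))\<^sup>2"
      if "expectation Z = 0"
    proof -
      have intZ: "integrable M Z"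
        using Bochner_Integration.integrable_add[OF int[of 1] integrable_const[of \<mu>]] by simp
      have "expectation (\<lambda>\<omega>. Z \<omega> - \<mu>) = 0"
        using E[of 1] integral_normal_moment_odd[OF \<sigma>, of \<mu> 0] by simp
      then have "\<mu> = 0" using that intZ by (simp add: prob_space)
      then show ?thesis
        using E[of 4] E[of 2] integral_normal_moment_even[OF \<sigma>, of \<mu> 1] integral_normal_moment_even[OF \<sigma>, of \<mu> 2]
        by (simp add: fact_numeral power_divide)
    qed
    ultimately show ?thesis by auto
  qed
  then show "integrable M (\<lambda>\<omega>. Z \<omega> ^ 4)"
    and "expectation Z = 0 \<Longrightarrow> expectation (\<lambda>\<omega>. Z \<omega> ^ 4) = 3 * (expectation (\<lambda>\<omega>. (Z \<omega>)\<^sup>2))\<^sup>2"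
    by auto
qed

lemma (in prob_space) normal_rv_add_const:
  assumes "normal_rv M Z"
  shows "normal_rv M (\<lambda>\<omega>. Z \<omega> + c)"
proof -
  have [measurable]: "Z \<in> borel_measurable M" using assms by (simp add: normal_rv_def)
  consider (normal) \<mu> \<sigma> where "\<sigma> > 0" "distributed M lborel Z (\<lambda>x. ennreal (normal_density \<mu> \<sigma> x))"
    | (const) \<mu> where "AE \<omega> in M. Z \<omega> = \<mu>"
    using assms by (auto simp: normal_rv_def)
  then show ?thesis
  proof cases
    case normal
    from normal_density_affine[OF normal(2,1), of 1 c] normal(1) show ?thesis
      by (auto simp: normal_rv_def add.commute)
  next
    case const
    then have "AE \<omega> in M. Z \<omega> + c = \<mu> + c" by eventually_elim simp
    then show ?thesis by (auto simp: normal_rv_def)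
  qed
qed

text \<open>A linear space of centred normal variables. Closure under linear combinations keeps all
  differences inside \<open>H\<close> and is exactly what polarisation of fourth moments
  requires.\<close>

locale gaussian_space = prob_space M for M :: "'a measure" +
  fixes H :: "('a \<Rightarrow> real) set"
  assumes normal: "U \<in> H \<Longrightarrow> normal_rv M U"
    and mean_0: "U \<in> H \<Longrightarrow> expectation U = 0"
    and lin: "U \<in> H \<Longrightarrow> V \<in> H \<Longrightarrow> (\<lambda>\<omega>. a * U \<omega> + b * V \<omega>) \<in> H"
begin

definition ip :: "('a \<Rightarrow> real) \<Rightarrow> ('a \<Rightarrow> real) \<Rightarrow> real" where
  "ip U V = expectation (\<lambda>\<omega>. U \<omega> * V \<omega>)"

lemma ip_commute: "ip U V = ip V U"
  by (simp add: ip_def mult.commute)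

lemma measurable_H [measurable_dest]: "U \<in> H \<Longrightarrow> U \<in> borel_measurable M"
  using normal by (auto simp: normal_rv_def)

lemma integrable_power4: "U \<in> H \<Longrightarrow> integrable M (\<lambda>\<omega>. U \<omega> ^ 4)"
  using normal normal_rv_moments(1) by blast

lemma expectation_power4: "U \<in> H \<Longrightarrow> expectation (\<lambda>\<omega>. U \<omega> ^ 4) = 3 * (ip U U)\<^sup>2"
  using normal normal_rv_moments(2) mean_0 by (simp add: ip_def power2_eq_square)

text \<open>The arithmetic-geometric mean inequality, applied twice, dominates the product by fourth
  powers.\<close>

lemma integrable_mult4:
  assumes "A \<in> H" "B \<in> H" "C \<in> H" "D \<in> H"
  shows "integrable M (\<lambda>\<omega>. A \<omega> * B \<omega> * (C \<omega> * D \<omega>))"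
proof (rule Bochner_Integration.integrable_bound)
  note [measurable] = assms
  show "integrable M (\<lambda>\<omega>. (A \<omega> ^ 4 + B \<omega> ^ 4) + (C \<omega> ^ 4 + D \<omega> ^ 4))"
    by (intro Bochner_Integration.integrable_add integrable_power4 assms)
  show "(\<lambda>\<omega>. A \<omega> * B \<omega> * (C \<omega> * D \<omega>)) \<in> borel_measurable M" by measurable
  have "\<bar>a * b * (c * d)\<bar> \<le> (a ^ 4 + b ^ 4) + (c ^ 4 + d ^ 4)" for a b c d :: real
  proof -
    have 1: "\<bar>x * y\<bar> \<le> (x\<^sup>2 + y\<^sup>2) / 2" for x y :: real
      using sum_squares_bound[of "\<bar>x\<bar>" "\<bar>y\<bar>"] by (simp add: abs_mult)
    have "(a * b)\<^sup>2 \<le> (a ^ 4 + b ^ 4) / 2"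
      using 1[of "a\<^sup>2" "b\<^sup>2"] by (simp add: power_mult_distrib)
    moreover have "(c * d)\<^sup>2 \<le> (c ^ 4 + d ^ 4) / 2"
      using 1[of "c\<^sup>2" "d\<^sup>2"] by (simp add: power_mult_distrib)
    moreover have "0 \<le> a ^ 4 + b ^ 4" "0 \<le> c ^ 4 + d ^ 4" by simp_all
    ultimately show ?thesis using 1[of "a * b" "c * d"] by argo
  qed
  then show "AE \<omega> in M. norm (A \<omega> * B \<omega> * (C \<omega> * D \<omega>)) \<le> norm ((A \<omega> ^ 4 + B \<omega> ^ 4) + (C \<omega> ^ 4 + D \<omega> ^ 4))"
    by (intro always_eventually allI) (simp add: abs_of_nonneg)
qed

lemma integrable_mult:
  assumes "U \<in> H" "V \<in> H"
  shows "integrable M (\<lambda>\<omega>. U \<omega> * V \<omega>)"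
proof (rule Bochner_Integration.integrable_bound)
  note [measurable] = assms
  show "integrable M (\<lambda>\<omega>. 1 + U \<omega> * V \<omega> * (U \<omega> * V \<omega>))"
    by (intro Bochner_Integration.integrable_add integrable_mult4 integrable_const assms)
  show "(\<lambda>\<omega>. U \<omega> * V \<omega>) \<in> borel_measurable M" by measurable
  have "\<bar>x\<bar> \<le> 1 + x * x" for x :: real
    using sum_squares_bound[of "\<bar>x\<bar>" 1] by (simp add: power2_eq_square)
  then show "AE \<omega> in M. norm (U \<omega> * V \<omega>) \<le> norm (1 + U \<omega> * V \<omega> * (U \<omega> * V \<omega>))"
    by (intro always_eventually allI) (simp add: abs_of_nonneg)
qed

lemma ip_lin_left:
  assumes "U \<in> H" "V \<in> H" "W \<in> H"
  shows "ip (\<lambda>\<omega>. a * U \<omega> + b * V \<omega>) W = a * ip U W + b * ip V W"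
  using integrable_mult[OF assms(1,3)] integrable_mult[OF assms(2,3)]
  by (simp add: ip_def distrib_right mult.assoc)

lemma ip_lin_right:
  assumes "U \<in> H" "V \<in> H" "W \<in> H"
  shows "ip W (\<lambda>\<omega>. a * U \<omega> + b * V \<omega>) = a * ip W U + b * ip W V"
  using ip_lin_left[OF assms] by (simp add: ip_commute)

text \<open>Polarisation of the normal fourth moment:
  \<open>(x + y) ^ 4 + (x - y) ^ 4 - 2 x ^ 4 - 2 y ^ 4\<close> equals
  \<open>12 x^2 y^2\<close>.\<close>

lemma expectation_square_square:
  assumes "P \<in> H" "Q \<in> H"
  shows "expectation (\<lambda>\<omega>. P \<omega> * P \<omega> * (Q \<omega> * Q \<omega>)) = ip P P * ip Q Q + 2 * (ip P Q)\<^sup>2"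
proof -
  \<comment> \<open>The factor \<open>1 *\<close> makes this literally an instance of
    \<open>lin\<close> and of the linearity rules for \<open>ip\<close>.\<close>
  define U where "U a = (\<lambda>\<omega>. 1 * P \<omega> + a * Q \<omega>)" for a :: real
  have U: "U a \<in> H" for a unfolding U_def by (intro lin assms)
  have ipU: "ip (U a) (U a) = ip P P + 2 * a * ip P Q + a\<^sup>2 * ip Q Q" for a
    unfolding U_def
    by (simp only: ip_lin_left ip_lin_right lin assms)
       (simp add: ip_commute[of Q P] power2_eq_square algebra_simps)
  note E = expectation_power4[OF U] expectation_power4[OF assms(1)] expectation_power4[OF assms(2)]
    and I = integrable_power4[OF U] integrable_power4[OF assms(1)] integrable_power4[OF assms(2)]
  have "12 * (x * x * (y * y)) = ((x + y) ^ 4 + (x + - 1 * y) ^ 4) - (2 * x ^ 4 + 2 * y ^ 4)" for x y :: real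
    by (simp add: power4_eq_xxxx algebra_simps)
  then have pol: "12 * (P \<omega> * P \<omega> * (Q \<omega> * Q \<omega>)) =
      (U 1 \<omega> ^ 4 + U (-1) \<omega> ^ 4) - (2 * P \<omega> ^ 4 + 2 * Q \<omega> ^ 4)" for \<omega>
    by (simp add: U_def)
  have "12 * expectation (\<lambda>\<omega>. P \<omega> * P \<omega> * (Q \<omega> * Q \<omega>)) =
      expectation (\<lambda>\<omega>. 12 * (P \<omega> * P \<omega> * (Q \<omega> * Q \<omega>)))" by simp
  also have "\<dots> = 12 * (ip P P * ip Q Q + 2 * (ip P Q)\<^sup>2)"
    unfolding pol by (simp add: I E ipU) (simp add: power2_eq_square algebra_simps)
  finally show ?thesis by simp
qed

text \<open>A second polarisation: \<open>4 a b = (a + b)^2 - (a - b)^2\<close>, and likewise for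
  \<open>c d\<close>, expresses \<open>16 a b c d\<close> by four products of two squares.\<close>

lemma isserlis:
  assumes "A \<in> H" "B \<in> H" "C \<in> H" "D \<in> H"
  shows "expectation (\<lambda>\<omega>. A \<omega> * B \<omega> * (C \<omega> * D \<omega>)) = ip A B * ip C D + ip A C * ip B D + ip A D * ip B C"
proof -
  define U V where "U b = (\<lambda>\<omega>. 1 * A \<omega> + b * B \<omega>)" and "V d = (\<lambda>\<omega>. 1 * C \<omega> + d * D \<omega>)" for b d :: real
  have UV: "U b \<in> H" "V d \<in> H" for b d unfolding U_def V_def by (intro lin assms)+
  have ips: "ip (U b) (U b) = ip A A + 2 * b * ip A B + b\<^sup>2 * ip B B"
    "ip (V d) (V d) = ip C C + 2 * d * ip C D + d\<^sup>2 * ip D D"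
    "ip (U b) (V d) = ip A C + d * ip A D + b * ip B C + b * d * ip B D" for b d
    unfolding U_def V_def
    by (simp_all only: ip_lin_left ip_lin_right lin assms)
       (simp_all add: ip_commute[of B A] ip_commute[of D C] power2_eq_square algebra_simps)
  note E = expectation_square_square[OF UV] and I = integrable_mult4[OF UV(1) UV(1) UV(2) UV(2)]
  have "16 * (a * b * (c * d)) =
      ((a + b) * (a + b) * ((c + d) * (c + d)) - (a + b) * (a + b) * ((c + - 1 * d) * (c + - 1 * d))) -
      ((a + - 1 * b) * (a + - 1 * b) * ((c + d) * (c + d)) -
       (a + - 1 * b) * (a + - 1 * b) * ((c + - 1 * d) * (c + - 1 * d)))" for a b c d :: real
    by (simp add: algebra_simps)
  then have pol: "16 * (A \<omega> * B \<omega> * (C \<omega> * D \<omega>)) =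
      (U 1 \<omega> * U 1 \<omega> * (V 1 \<omega> * V 1 \<omega>) - U 1 \<omega> * U 1 \<omega> * (V (-1) \<omega> * V (-1) \<omega>)) -
      (U (-1) \<omega> * U (-1) \<omega> * (V 1 \<omega> * V 1 \<omega>) - U (-1) \<omega> * U (-1) \<omega> * (V (-1) \<omega> * V (-1) \<omega>))" for \<omega>
    by (simp add: U_def V_def)
  have "16 * expectation (\<lambda>\<omega>. A \<omega> * B \<omega> * (C \<omega> * D \<omega>)) =
      expectation (\<lambda>\<omega>. 16 * (A \<omega> * B \<omega> * (C \<omega> * D \<omega>)))" by simp
  also have "\<dots> = 16 * (ip A B * ip C D + ip A C * ip B D + ip A D * ip B C)"
    unfolding pol by (simp only: Bochner_Integration.integral_diff Bochner_Integration.integrable_diff I E ips)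
      (simp add: power2_eq_square algebra_simps)
  finally show ?thesis by simp
qed

lemma nabla_in_H:
  assumes "\<And>s. Z s \<in> H"
  shows "(\<lambda>\<omega>. (nabla h ^^ q) (\<lambda>s. Z s \<omega>) s) \<in> H"
proof (induction q arbitrary: s)
  case (Suc q)
  have "(\<lambda>\<omega>. (nabla h ^^ Suc q) (\<lambda>s. Z s \<omega>) s) =
      (\<lambda>\<omega>. (1 / h) * (nabla h ^^ q) (\<lambda>s. Z s \<omega>) (s + h) + (- 1 / h) * (nabla h ^^ q) (\<lambda>s. Z s \<omega>) s)"
    unfolding nabla_funpow_Suc by (simp add: diff_divide_distrib)
  then show ?case by (simp only: lin Suc)
qed (simp add: assms)

lemma ip_nabla_left:
  assumes H: "\<And>s. Z s \<in> H" "V \<in> H" and ip: "\<And>s. ip (Z s) V = f (s - u)"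
  shows "ip (\<lambda>\<omega>. (nabla h ^^ q) (\<lambda>s. Z s \<omega>) s) V = (nabla h ^^ q) f (s - u)"
proof (induction q arbitrary: s)
  case (Suc q)
  have "(\<lambda>\<omega>. (nabla h ^^ Suc q) (\<lambda>s. Z s \<omega>) s) =
      (\<lambda>\<omega>. (1 / h) * (nabla h ^^ q) (\<lambda>s. Z s \<omega>) (s + h) + (- 1 / h) * (nabla h ^^ q) (\<lambda>s. Z s \<omega>) s)"
    unfolding nabla_funpow_Suc by (simp add: diff_divide_distrib)
  then have "ip (\<lambda>\<omega>. (nabla h ^^ Suc q) (\<lambda>s. Z s \<omega>) s) V =
      (1 / h) * (nabla h ^^ q) f (s + h - u) + (- 1 / h) * (nabla h ^^ q) f (s - u)"
    by (simp only: ip_lin_left nabla_in_H H Suc)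
  then show ?case unfolding nabla_funpow_Suc by (simp add: diff_divide_distrib algebra_simps)
qed (simp add: ip)

text \<open>Moving the second argument forward moves the lag backward: each difference changes the
  sign and shifts the lag by \<open>- h\<close>.\<close>

lemma ip_nabla_right:
  assumes H: "\<And>s. Z s \<in> H" "V \<in> H" and ip: "\<And>u. ip V (Z u) = f (s - u)"
  shows "ip V (\<lambda>\<omega>. (nabla h ^^ q) (\<lambda>s. Z s \<omega>) u) = (-1) ^ q * (nabla h ^^ q) f (s - u - real q * h)"
proof (induction q arbitrary: u)
  case (Suc q)
  have "(\<lambda>\<omega>. (nabla h ^^ Suc q) (\<lambda>s. Z s \<omega>) u) =
      (\<lambda>\<omega>. (1 / h) * (nabla h ^^ q) (\<lambda>s. Z s \<omega>) (u + h) + (- 1 / h) * (nabla h ^^ q) (\<lambda>s. Z s \<omega>) u)"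
    unfolding nabla_funpow_Suc by (simp add: diff_divide_distrib)
  then have "ip V (\<lambda>\<omega>. (nabla h ^^ Suc q) (\<lambda>s. Z s \<omega>) u) =
      (1 / h) * ((-1) ^ q * (nabla h ^^ q) f (s - (u + h) - real q * h)) +
      (- 1 / h) * ((-1) ^ q * (nabla h ^^ q) f (s - u - real q * h))"
    by (simp only: ip_lin_right nabla_in_H H Suc)
  moreover have "s - (u + h) - real q * h = s - u - real (Suc q) * h"
    "s - u - real q * h = s - u - real (Suc q) * h + h"
    by (simp_all add: algebra_simps)
  ultimately show ?case unfolding nabla_funpow_Suc by (simp add: diff_divide_distrib algebra_simps)
qed (simp add: ip)

text \<open>The orders of the two differences add up to \<open>2 p\<close>, and the shift by
  \<open>p h\<close> coming from the second argument centres the resulting difference at lag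
  \<open>s - u\<close>.\<close>

lemma ip_nabla_nabla:
  assumes H: "\<And>s. Z1 s \<in> H" "\<And>s. Z2 s \<in> H" and ip: "\<And>s u. ip (Z1 s) (Z2 u) = f (s - u)"
  shows "ip (\<lambda>\<omega>. (nabla h ^^ p) (\<lambda>s. Z1 s \<omega>) s) (\<lambda>\<omega>. (nabla h ^^ p) (\<lambda>s. Z2 s \<omega>) u) =
    (-1) ^ p * (nabla h ^^ (2 * p)) f (s - u - real p * h)"
proof -
  let ?g = "\<lambda>t. (-1) ^ p * (nabla h ^^ p) f (t + - real p * h)"
  have "ip (Z1 s) (\<lambda>\<omega>. (nabla h ^^ p) (\<lambda>s. Z2 s \<omega>) u) = ?g (s - u)" for s
    using ip_nabla_right[of Z2 "Z1 s" f s] H ip by simp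
  then have "ip (\<lambda>\<omega>. (nabla h ^^ p) (\<lambda>s. Z1 s \<omega>) s) (\<lambda>\<omega>. (nabla h ^^ p) (\<lambda>s. Z2 s \<omega>) u) =
      (nabla h ^^ p) ?g (s - u)"
    by (intro ip_nabla_left nabla_in_H H)
  also have "\<dots> = (-1) ^ p * (nabla h ^^ p) ((nabla h ^^ p) f) (s - u + - real p * h)"
    unfolding nabla_funpow_cmult nabla_funpow_shift ..
  finally show ?thesis
    using funpow_add[of p p "nabla h"] by (simp add: mult_2)
qed

text \<open>Of the three pairings in Isserlis' formula, the one within each product equals
  \<open>\<rho>^2\<close> and is cancelled by the centring; the other two remain.\<close>

lemma expectation_square_sum_mult:
  assumes "finite J" and U: "\<And>j. j \<in> J \<Longrightarrow> U j \<in> H" and V: "\<And>j. j \<in> J \<Longrightarrow> V j \<in> H"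
    and \<rho>: "\<And>j. j \<in> J \<Longrightarrow> ip (U j) (V j) = \<rho>"
  shows "integrable M (\<lambda>\<omega>. (\<Sum>j\<in>J. U j \<omega> * V j \<omega> - \<rho>)\<^sup>2)"
    and "expectation (\<lambda>\<omega>. (\<Sum>j\<in>J. U j \<omega> * V j \<omega> - \<rho>)\<^sup>2) =
      (\<Sum>i\<in>J. \<Sum>j\<in>J. ip (U i) (U j) * ip (V i) (V j) + ip (U i) (V j) * ip (V i) (U j))"
proof -
  let ?Y = "\<lambda>i j \<omega>. (U i \<omega> * V i \<omega> - \<rho>) * (U j \<omega> * V j \<omega> - \<rho>)"
  have expand: "?Y i j = (\<lambda>\<omega>. U i \<omega> * V i \<omega> * (U j \<omega> * V j \<omega>) - (\<rho> * (U i \<omega> * V i \<omega>) + \<rho> * (U j \<omega> * V j \<omega>) - \<rho>\<^sup>2))" for i j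
    by (simp add: fun_eq_iff power2_eq_square algebra_simps)
  have int: "integrable M (?Y i j)" if "i \<in> J" "j \<in> J" for i j
    unfolding expand using that
    by (intro Bochner_Integration.integrable_add Bochner_Integration.integrable_diff integrable_mult_right
        integrable_mult integrable_mult4 U V integrable_const)
  have E: "expectation (?Y i j) = ip (U i) (U j) * ip (V i) (V j) + ip (U i) (V j) * ip (V i) (U j)"
    if ij: "i \<in> J" "j \<in> J" for i j
  proof -
    have "expectation (\<lambda>\<omega>. U k \<omega> * V k \<omega>) = \<rho>" if "k \<in> J" for k
      using \<rho>[OF that] by (simp add: ip_def)
    then show ?thesis
      unfolding expand using ij
      by (simp add: isserlis integrable_mult integrable_mult4 U V \<rho> prob_space power2_eq_square)
  qed
  have sq: "(\<lambda>\<omega>. (\<Sum>j\<in>J. U j \<omega> * V j \<omega> - \<rho>)\<^sup>2) = (\<lambda>\<omega>. \<Sum>i\<in>J. \<Sum>j\<in>J. ?Y i j \<omega>)"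
    by (simp add: fun_eq_iff power2_eq_square sum_product)
  show "integrable M (\<lambda>\<omega>. (\<Sum>j\<in>J. U j \<omega> * V j \<omega> - \<rho>)\<^sup>2)"
    unfolding sq by (intro Bochner_Integration.integrable_sum int)
  have "expectation (\<lambda>\<omega>. \<Sum>i\<in>J. \<Sum>j\<in>J. ?Y i j \<omega>) = (\<Sum>i\<in>J. \<Sum>j\<in>J. expectation (?Y i j))"
    by (subst Bochner_Integration.integral_sum, intro Bochner_Integration.integrable_sum int, assumption+)
       (intro sum.cong refl Bochner_Integration.integral_sum int)
  then show "expectation (\<lambda>\<omega>. (\<Sum>j\<in>J. U j \<omega> * V j \<omega> - \<rho>)\<^sup>2) =
      (\<Sum>i\<in>J. \<Sum>j\<in>J. ip (U i) (U j) * ip (V i) (V j) + ip (U i) (V j) * ip (V i) (U j))"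
    unfolding sq by (simp add: E)
qed

end

text \<open>With truncated subtraction \<open>(i - j) + (j - i)\<close> is the distance of \<open>i\<close> and \<open>j\<close>.\<close>

lemma sum_sum_lag_le:
  fixes r :: "nat \<Rightarrow> real"
  assumes "\<And>m. m \<le> k \<Longrightarrow> 0 \<le> r m"
  shows "(\<Sum>i\<le>k. \<Sum>j\<le>k. r ((i - j) + (j - i))) \<le> 2 * real (k + 1) * (\<Sum>m\<le>k. r m)"
proof -
  have "(\<Sum>j\<le>k. r ((i - j) + (j - i))) \<le> 2 * (\<Sum>m\<le>k. r m)" if i: "i \<le> k" for i
  proof -
    have "(\<Sum>j\<le>k. r ((i - j) + (j - i))) =
        (\<Sum>j\<in>{..i}. r ((i - j) + (j - i))) + (\<Sum>j\<in>{i<..k}. r ((i - j) + (j - i)))"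
      using i by (subst sum.union_disjoint[symmetric]) (auto intro!: sum.cong)
    also have "(\<Sum>j\<in>{..i}. r ((i - j) + (j - i))) = (\<Sum>m\<in>{..i}. r m)"
      by (rule sum.reindex_bij_witness[of _ "\<lambda>m. i - m" "\<lambda>j. i - j"]) auto
    also have "\<dots> \<le> (\<Sum>m\<le>k. r m)"
      using i assms by (intro sum_mono2) auto
    also have "(\<Sum>j\<in>{i<..k}. r ((i - j) + (j - i))) = (\<Sum>m\<in>{1..k-i}. r m)"
      by (rule sum.reindex_bij_witness[of _ "\<lambda>m. i + m" "\<lambda>j. j - i"]) auto
    also have "\<dots> \<le> (\<Sum>m\<le>k. r m)"
      using i assms by (intro sum_mono2) auto
    finally show ?thesis by simp
  qed
  then have "(\<Sum>i\<le>k. \<Sum>j\<le>k. r ((i - j) + (j - i))) \<le> (\<Sum>i\<le>k. 2 * (\<Sum>m\<le>k. r m))"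
    by (intro sum_mono) auto
  then show ?thesis by (simp add: algebra_simps)
qed

section \<open>Consistency\<close>

text \<open>Where \<open>\<bar>A\<bar> < \<epsilon> / 2\<close> and
  \<open>\<bar>B - 1\<bar> < 1 / 2\<close>, the ratio is below \<epsilon> in absolute value;
  Markov's inequality for the squares bounds both exceptional events. Zeros of \<open>B\<close> lie
  in the second one, so \<open>T\<close> may take any value there.\<close>

lemma (in prob_space) tendsto_in_prob_ratio:
  fixes T A B :: "nat \<Rightarrow> 'a \<Rightarrow> real"
  assumes T: "\<And>n. T n \<in> borel_measurable M"
    and ratio: "eventually (\<lambda>n. \<forall>\<omega>. B n \<omega> \<noteq> 0 \<longrightarrow> T n \<omega> - l = A n \<omega> / B n \<omega>) sequentially"
    and intA: "eventually (\<lambda>n. integrable M (\<lambda>\<omega>. (A n \<omega>)\<^sup>2)) sequentially"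
    and limA: "(\<lambda>n. expectation (\<lambda>\<omega>. (A n \<omega>)\<^sup>2)) \<longlonglongrightarrow> 0"
    and intB: "eventually (\<lambda>n. integrable M (\<lambda>\<omega>. (B n \<omega> - 1)\<^sup>2)) sequentially"
    and limB: "(\<lambda>n. expectation (\<lambda>\<omega>. (B n \<omega> - 1)\<^sup>2)) \<longlonglongrightarrow> 0"
  shows "tendsto_in_prob M T l"
  unfolding tendsto_in_prob_def
proof (intro conjI allI impI T)
  fix \<epsilon> :: real assume \<epsilon>: "\<epsilon> > 0"
  let ?ub = "\<lambda>n. expectation (\<lambda>\<omega>. (A n \<omega>)\<^sup>2) / (\<epsilon> / 2)\<^sup>2 + expectation (\<lambda>\<omega>. (B n \<omega> - 1)\<^sup>2) / (1 / 2)\<^sup>2"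
  have "?ub \<longlonglongrightarrow> 0 / (\<epsilon> / 2)\<^sup>2 + 0 / (1 / 2)\<^sup>2"
    by (intro tendsto_add tendsto_divide limA limB tendsto_const) (use \<epsilon> in auto)
  then have lim: "?ub \<longlonglongrightarrow> 0" by simp
  have "eventually (\<lambda>n. prob {\<omega> \<in> space M. \<bar>T n \<omega> - l\<bar> > \<epsilon>} \<le> ?ub n) sequentially"
    using ratio intA intB
  proof eventually_elim
    case (elim n)
    note [measurable] = T[of n] borel_measurable_integrable[OF elim(2)] borel_measurable_integrable[OF elim(3)]
    let ?S1 = "{\<omega> \<in> space M. (A n \<omega>)\<^sup>2 \<ge> (\<epsilon> / 2)\<^sup>2}" and ?S2 = "{\<omega> \<in> space M. (B n \<omega> - 1)\<^sup>2 \<ge> (1 / 2)\<^sup>2}"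
    have meas: "?S1 \<in> events" "?S2 \<in> events" by measurable
    have "{\<omega> \<in> space M. \<bar>T n \<omega> - l\<bar> > \<epsilon>} \<subseteq> ?S1 \<union> ?S2"
    proof (rule subsetI, rule ccontr)
      fix \<omega> assume "\<omega> \<in> {\<omega> \<in> space M. \<bar>T n \<omega> - l\<bar> > \<epsilon>}" and *: "\<omega> \<notin> ?S1 \<union> ?S2"
      then have \<omega>: "\<omega> \<in> space M" "\<epsilon> < \<bar>T n \<omega> - l\<bar>" by auto
      have 1: "\<bar>A n \<omega>\<bar> < \<epsilon> / 2"
        using * \<omega>(1) \<epsilon> by (intro power2_less_imp_less[of "\<bar>A n \<omega>\<bar>"]) auto
      have 2: "\<bar>B n \<omega> - 1\<bar> < 1 / 2"
        using * \<omega>(1) by (intro power2_less_imp_less[of "\<bar>B n \<omega> - 1\<bar>"]) auto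
      then have "B n \<omega> > 1 / 2" by linarith
      moreover from this have "T n \<omega> - l = A n \<omega> / B n \<omega>" using elim(1) by auto
      ultimately have "\<epsilon> * B n \<omega> < \<bar>A n \<omega>\<bar>"
        using \<omega>(2) by (simp add: abs_divide pos_less_divide_eq)
      moreover have "\<epsilon> * (1 / 2) < \<epsilon> * B n \<omega>"
        using \<epsilon> \<open>B n \<omega> > 1 / 2\<close> by (intro mult_strict_left_mono) auto
      ultimately show False using 1 by simp
    qed
    then have "prob {\<omega> \<in> space M. \<bar>T n \<omega> - l\<bar> > \<epsilon>} \<le> prob (?S1 \<union> ?S2)"
      using meas by (intro finite_measure_mono) auto
    also have "\<dots> \<le> prob ?S1 + prob ?S2"
      using meas by (rule measure_Un_le)
    also have "prob ?S1 \<le> expectation (\<lambda>\<omega>. (A n \<omega>)\<^sup>2) / (\<epsilon> / 2)\<^sup>2"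
      by (rule integral_Markov_inequality_measure[OF elim(2) sets.empty_sets]) (use \<epsilon> in auto)
    also have "prob ?S2 \<le> expectation (\<lambda>\<omega>. (B n \<omega> - 1)\<^sup>2) / (1 / 2)\<^sup>2"
      by (rule integral_Markov_inequality_measure[OF elim(3) sets.empty_sets]) auto
    finally show ?case by simp
  qed
  then show "(\<lambda>n. prob {\<omega> \<in> space M. \<bar>T n \<omega> - l\<bar> > \<epsilon>}) \<longlonglongrightarrow> 0"
    by (rule tendsto_sandwich[OF _ _ tendsto_const lim, rotated]) simp
qed

section \<open>Second moments of sums over the grid\<close>

context gaussian_space
begin

definition grid_diff :: "(real \<Rightarrow> 'a \<Rightarrow> real) \<Rightarrow> real \<Rightarrow> nat \<Rightarrow> nat \<Rightarrow> 'a \<Rightarrow> real" where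
  "grid_diff Z h p j = (\<lambda>\<omega>. (nabla h ^^ p) (\<lambda>s. Z s \<omega>) (h * real j))"

lemma grid_diff_in_H: "(\<And>s. Z s \<in> H) \<Longrightarrow> grid_diff Z h p j \<in> H"
  unfolding grid_diff_def by (rule nabla_in_H)

text \<open>The lag \<open>i - j\<close> is a truncated difference, hence \<open>j \<le> i\<close>;
  the opposite order is reached by \<open>ip_commute\<close>.\<close>

lemma ip_grid_diff:
  assumes "\<And>s. Z1 s \<in> H" "\<And>s. Z2 s \<in> H" "\<And>s u. ip (Z1 s) (Z2 u) = f (s - u)" "j \<le> i"
  shows "ip (grid_diff Z1 h p i) (grid_diff Z2 h p j) =
     (-1) ^ p * (nabla h ^^ (2 * p)) f ((real (i - j) - real p) * h)"
proof -
  have "h * real i - h * real j - real p * h = (real (i - j) - real p) * h"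
    using assms(4) by (simp add: of_nat_diff algebra_simps)
  then show ?thesis
    using ip_nabla_nabla[of Z1 Z2 f, OF assms(1-3)] by (simp add: grid_diff_def)
qed

text \<open>A general pair of fields lets one statement serve the numerator and, with
  \<open>Z2\<close> equal to \<open>Z1\<close>, the denominator. The two pairings left by Isserlis'
  formula have total exponents \<open>a1 + a2\<close> and \<open>2 * a\<close>, and the lag sum
  criterion is applied to each.\<close>

lemma square_sum_negligible:
  assumes H: "\<And>s. Z1 s \<in> H" "\<And>s. Z2 s \<in> H"
    and ip11: "\<And>s u. ip (Z1 s) (Z1 u) = K11 (s - u)" and ip22: "\<And>s u. ip (Z2 s) (Z2 u) = K22 (s - u)"
    and ip12: "\<And>s u. ip (Z1 s) (Z2 u) = K12 (s - u)" and ip21: "\<And>s u. ip (Z2 s) (Z1 u) = K21 (s - u)"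
    and lb: "lag_bound K11 L p a1" "lag_bound K22 L p a2" "lag_bound K12 L p a" "lag_bound K21 L p a"
    and L: "L > 0" and p: "p > 0" and \<alpha>: "\<alpha> < 2 * real p"
    and a: "2 * \<alpha> - 1 < a1 + a2" "2 * \<alpha> - 1 < 2 * a"
    and \<kappa>: "\<kappa> > 0" and v: "eventually (\<lambda>n. \<kappa> * (L / real n) powr (\<alpha> - 2 * real p) \<le> v n) sequentially"
  shows "(\<lambda>n. expectation (\<lambda>\<omega>. (\<Sum>j\<le>n-p. grid_diff Z1 (L / real n) p j \<omega> * grid_diff Z2 (L / real n) p j \<omega> -
            ip (grid_diff Z1 (L / real n) p 0) (grid_diff Z2 (L / real n) p 0))\<^sup>2) /
          (real (n - p + 1) * v n)\<^sup>2) \<longlonglongrightarrow> 0"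
proof -
  let ?q = "2 * real p"
  let ?y = "\<lambda>n m. real (m + 1) * (L / real n)"
  let ?S = "\<lambda>e n. (\<Sum>m<n. ?y n m powr (e - 2 * ?q)) / (real n * ((L / real n) powr (\<alpha> - ?q))\<^sup>2)"
  let ?bd = "\<lambda>Z Z' b C. C \<ge> 0 \<and> (\<forall>n i j. 2 * p \<le> n \<longrightarrow> i \<le> n - p \<longrightarrow> j \<le> i \<longrightarrow>
      \<bar>ip (grid_diff Z (L / real n) p i) (grid_diff Z' (L / real n) p j)\<bar> \<le> C * ?y n (i - j) powr (b - ?q))"
  have bound: "\<exists>C. ?bd Z Z' b C"
    if lbf: "lag_bound f L p b" and Z: "\<And>s. Z s \<in> H" "\<And>s. Z' s \<in> H" "\<And>s u. ip (Z s) (Z' u) = f (s - u)" for f b Z Z'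
  proof -
    obtain C where C: "C \<ge> 0 \<and> (\<forall>n m. 2 * p \<le> n \<longrightarrow> m + p \<le> n \<longrightarrow>
       \<bar>(nabla (L / real n) ^^ (2 * p)) f ((real m - real p) * (L / real n))\<bar> \<le> C * ?y n m powr (b - ?q))"
      using lbf unfolding lag_bound_def by (rule exE)
    show ?thesis
    proof (intro exI[of _ C] conjI allI impI)
      show "C \<ge> 0" using C by (rule conjunct1)
      fix n i j assume nij: "2 * p \<le> n" "i \<le> n - p" "j \<le> i"
      then have "i - j + p \<le> n" by linarith
      from C[THEN conjunct2, rule_format, OF nij(1) this] show
        "\<bar>ip (grid_diff Z (L / real n) p i) (grid_diff Z' (L / real n) p j)\<bar> \<le> C * ?y n (i - j) powr (b - ?q)"
        unfolding ip_grid_diff[of Z Z' f, OF Z nij(3)] by (simp add: abs_mult)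
    qed
  qed
  obtain C11 where C11: "?bd Z1 Z1 a1 C11"
    using bound[of K11 _ Z1 Z1, OF lb(1) H(1) H(1) ip11] by (rule exE)
  obtain C22 where C22: "?bd Z2 Z2 a2 C22"
    using bound[of K22 _ Z2 Z2, OF lb(2) H(2) H(2) ip22] by (rule exE)
  obtain C12 where C12: "?bd Z1 Z2 a C12"
    using bound[of K12 _ Z1 Z2, OF lb(3) H(1) H(2) ip12] by (rule exE)
  obtain C21 where C21: "?bd Z2 Z1 a C21"
    using bound[of K21 _ Z2 Z1, OF lb(4) H(2) H(1) ip21] by (rule exE)
  note C11 = C11[THEN conjunct1] C11[THEN conjunct2, rule_format]
    and C22 = C22[THEN conjunct1] C22[THEN conjunct2, rule_format]
    and C12 = C12[THEN conjunct1] C12[THEN conjunct2, rule_format]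
    and C21 = C21[THEN conjunct1] C21[THEN conjunct2, rule_format]
  \<comment> \<open>In the 4, one factor 2 counts both signs of the lag and the other comes from
    \<open>n - p + 1 \<ge> n / 2\<close>; \<open>\<kappa>^2\<close> comes from the squared lower
    bound on \<open>v\<close>.\<close>
  let ?ub = "\<lambda>n. 4 / \<kappa>\<^sup>2 * (C11 * C22 * ?S (a1 + a2) n + C12 * C21 * ?S (2 * a) n)"
  let ?E = "\<lambda>n. expectation (\<lambda>\<omega>. (\<Sum>j\<le>n-p. grid_diff Z1 (L / real n) p j \<omega> * grid_diff Z2 (L / real n) p j \<omega> -
            ip (grid_diff Z1 (L / real n) p 0) (grid_diff Z2 (L / real n) p 0))\<^sup>2)"
  have ub: "eventually (\<lambda>n. ?E n / (real (n - p + 1) * v n)\<^sup>2 \<le> ?ub n) sequentially"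
    using v eventually_ge_at_top[of "2 * p"]
  proof eventually_elim
    case (elim n)
    define h where "h = L / real n"
    define U V where "U = grid_diff Z1 h p" and "V = grid_diff Z2 h p"
    define r where "r m = C11 * C22 * ?y n m powr (a1 + a2 - 2 * ?q) + C12 * C21 * ?y n m powr (2 * a - 2 * ?q)" for m
    have n0: "n > 0" using elim p by auto
    have h0: "h > 0" using L n0 by (simp add: h_def)
    have UV: "U j \<in> H" "V j \<in> H" for j unfolding U_def V_def by (intro grid_diff_in_H H)+
    have \<rho>: "ip (U j) (V j) = ip (U 0) (V 0)" for j
      unfolding U_def V_def using ip_grid_diff[of Z1 Z2 K12, OF H ip12] by simp
    have r0: "r m \<ge> 0" for m using C11(1) C22(1) C12(1) C21(1) by (simp add: r_def)
    have le: "\<bar>ip (U i) (U j) * ip (V i) (V j)\<bar> + \<bar>ip (U i) (V j) * ip (V i) (U j)\<bar> \<le> r (i - j)"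
      if ij: "i \<le> n - p" "j \<le> i" for i j
    proof -
      have "\<bar>ip (U i) (U j) * ip (V i) (V j)\<bar> \<le>
          (C11 * ?y n (i - j) powr (a1 - ?q)) * (C22 * ?y n (i - j) powr (a2 - ?q))"
        unfolding abs_mult U_def V_def h_def
        using C11(1) C22(1) elim(2) ij by (intro mult_mono C11(2) C22(2)) auto
      moreover have "\<bar>ip (U i) (V j) * ip (V i) (U j)\<bar> \<le>
          (C12 * ?y n (i - j) powr (a - ?q)) * (C21 * ?y n (i - j) powr (a - ?q))"
        unfolding abs_mult U_def V_def h_def
        using C12(1) C21(1) elim(2) ij by (intro mult_mono C12(2) C21(2)) auto
      moreover have "(C * ?y n (i - j) powr (b - ?q)) * (D * ?y n (i - j) powr (d - ?q)) =
          C * D * ?y n (i - j) powr (b + d - 2 * ?q)" for C D b d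
      proof -
        have "b + d - 2 * ?q = (b - ?q) + (d - ?q)" by simp
        then show ?thesis by (simp only: powr_add mult_ac)
      qed
      ultimately show ?thesis unfolding r_def by (simp only: mult_2[of a])
    qed
    have term_le: "ip (U i) (U j) * ip (V i) (V j) + ip (U i) (V j) * ip (V i) (U j) \<le> r ((i - j) + (j - i))"
      if "i \<le> n - p" "j \<le> n - p" for i j
    proof (cases "j \<le> i")
      case True
      then show ?thesis using le[of i j] that by simp
    next
      case False
      have eq: "ip (U i) (U j) = ip (U j) (U i)" "ip (V i) (V j) = ip (V j) (V i)"
        "ip (U i) (V j) = ip (V j) (U i)" "ip (V i) (U j) = ip (U j) (V i)"
        by (rule ip_commute)+
      show ?thesis unfolding eq using False le[of j i] that by (simp add: mult.commute)
    qed
    have "?E n = (\<Sum>i\<le>n-p. \<Sum>j\<le>n-p. ip (U i) (U j) * ip (V i) (V j) + ip (U i) (V j) * ip (V i) (U j))"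
      unfolding h_def[symmetric] U_def[symmetric] V_def[symmetric]
      by (rule expectation_square_sum_mult(2)[of "{..n-p}" U V]) (rule finite_atMost UV \<rho>)+
    also have "\<dots> \<le> (\<Sum>i\<le>n-p. \<Sum>j\<le>n-p. r ((i - j) + (j - i)))"
      by (intro sum_mono term_le) auto
    also have "\<dots> \<le> 2 * real (n - p + 1) * (\<Sum>m\<le>n-p. r m)"
      by (rule sum_sum_lag_le) (rule r0)
    \<comment> \<open>Since \<open>p > 0\<close>, the lags up to \<open>n - p\<close> are all below
      \<open>n\<close>.\<close>
    also have "(\<Sum>m\<le>n-p. r m) \<le> (\<Sum>m<n. r m)"
      using p n0 by (intro sum_mono2 r0) auto
    finally have E: "?E n \<le> 2 * real (n - p + 1) * (\<Sum>m<n. r m)" by simp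
    let ?N = "real (n - p + 1)"
    define w where "w = \<kappa> * h powr (\<alpha> - ?q)"
    have w0: "w > 0" using \<kappa> h0 by (simp add: w_def)
    have "w \<le> v n" using elim(1) by (simp add: w_def h_def)
    have N: "real n / 2 \<le> ?N" using elim(2) by linarith
    have N0: "?N > 0" by simp
    have S0: "0 \<le> (\<Sum>m<n. r m)" by (intro sum_nonneg r0)
    have "?E n / (?N * v n)\<^sup>2 \<le> 2 * ?N * (\<Sum>m<n. r m) / (?N * v n)\<^sup>2"
      by (intro divide_right_mono E) auto
    also have "\<dots> = 2 * (\<Sum>m<n. r m) / (?N * (v n)\<^sup>2)"
    proof -
      have "2 * N * S / (N * w)\<^sup>2 = 2 * S / (N * w\<^sup>2)" if "N > 0" for N S w :: real
        using that by (simp add: power2_eq_square)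
      then show ?thesis using N0 .
    qed
    also have "\<dots> \<le> 2 * (\<Sum>m<n. r m) / (real n / 2 * w\<^sup>2)"
    proof (intro divide_left_mono mult_mono power_mono)
      show "0 < ?N * (v n)\<^sup>2 * (real n / 2 * w\<^sup>2)"
        using N0 w0 n0 \<open>w \<le> v n\<close> by (intro mult_pos_pos zero_less_power) auto
    qed (use N w0 \<open>w \<le> v n\<close> S0 in auto)
    also have "\<dots> = ?ub n"
    proof -
      have "(\<Sum>m<n. r m) = C11 * C22 * (\<Sum>m<n. ?y n m powr (a1 + a2 - 2 * ?q)) +
          C12 * C21 * (\<Sum>m<n. ?y n m powr (2 * a - 2 * ?q))"
        by (simp add: r_def sum.distrib sum_distrib_left)
      moreover have "2 * (A * s + B * t) / (N / 2 * (\<kappa> * x)\<^sup>2) =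
          4 / \<kappa>\<^sup>2 * (A * (s / (N * x\<^sup>2)) + B * (t / (N * x\<^sup>2)))" if "N > 0" "x > 0" for A B s t N x :: real
        using that \<kappa> by (simp add: power_mult_distrib field_simps)
      ultimately show ?thesis
        unfolding w_def h_def[symmetric] using n0 h0 by (simp only: of_nat_0_less_iff powr_gt_zero)
    qed
    finally show ?case .
  qed
  have "?ub \<longlonglongrightarrow> 4 / \<kappa>\<^sup>2 * (C11 * C22 * 0 + C12 * C21 * 0)"
    by (intro tendsto_mult[OF tendsto_const] tendsto_add lag_sum_negligible[OF \<alpha>] a L)
  then have "?ub \<longlonglongrightarrow> 0" by (simp only: mult_zero_right add_0_right)
  from tendsto_sandwich[OF _ ub tendsto_const this] show ?thesis
    by (simp add: divide_nonneg_nonneg)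
qed

text \<open>Numerator and denominator are both divided by the expected denominator
  \<open>?N n * v n\<close>. The numerator then splits into a centred part, controlled by its
  variance, and the mean ratio \<open>\<rho> n / v n\<close>; the denominator is compared with
  1.\<close>

lemma difference_ratio_consistent:
  assumes H: "\<And>s. Z1 s \<in> H" "\<And>s. Z2 s \<in> H"
    and ip11: "\<And>s u. ip (Z1 s) (Z1 u) = K11 (s - u)" and ip22: "\<And>s u. ip (Z2 s) (Z2 u) = K22 (s - u)"
    and ip12: "\<And>s u. ip (Z1 s) (Z2 u) = K12 (s - u)" and ip21: "\<And>s u. ip (Z2 s) (Z1 u) = K21 (s - u)"
    and K11: "condition_A K11 L c11 \<alpha>11" "c11 \<noteq> 0" and K22: "condition_A K22 L c22 \<alpha>22"
    and K12: "a > \<alpha>11" "lag_bound K12 L p a" "lag_bound K21 L p a"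
    and L: "L > 0" and p: "\<alpha>11 < 2 * real p" and \<alpha>22: "\<alpha>11 < \<alpha>22 + 1"
    and T: "\<And>n. T n \<in> borel_measurable M"
    and ratio: "eventually (\<lambda>n. \<forall>\<omega>. (\<Sum>j\<le>n-p. (grid_diff Z1 (L / real n) p j \<omega>)\<^sup>2) \<noteq> 0 \<longrightarrow>
        T n \<omega> - l = (\<Sum>j\<le>n-p. grid_diff Z1 (L / real n) p j \<omega> * grid_diff Z2 (L / real n) p j \<omega>) /
          (\<Sum>j\<le>n-p. (grid_diff Z1 (L / real n) p j \<omega>)\<^sup>2)) sequentially"
  shows "tendsto_in_prob M T l"
proof -
  have \<alpha>0: "\<alpha>11 > 0" using K11 by (simp add: condition_A_def)
  then have p0: "p > 0" using p by (cases p) auto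
  define U V where "U n = grid_diff Z1 (L / real n) p" and "V n = grid_diff Z2 (L / real n) p" for n
  have UV: "U n j \<in> H" "V n j \<in> H" for n j unfolding U_def V_def by (intro grid_diff_in_H H)+
  define v where "v n = ip (U n 0) (U n 0)" for n
  define \<rho> where "\<rho> n = ip (U n 0) (V n 0)" for n
  have v_eq: "v n = (-1) ^ p * (nabla (L / real n) ^^ (2 * p)) K11 (- real p * (L / real n))" for n
    using ip_grid_diff[of Z1 Z1 K11 0 0, OF H(1) H(1) ip11] by (simp add: v_def U_def)
  have \<rho>_eq: "\<rho> n = (-1) ^ p * (nabla (L / real n) ^^ (2 * p)) K12 (- real p * (L / real n))" for n
    using ip_grid_diff[of Z1 Z2 K12 0 0, OF H ip12] by (simp add: \<rho>_def U_def V_def)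
  have v_abs: "\<bar>(nabla (L / real n) ^^ (2 * p)) K11 (- real p * (L / real n))\<bar> = v n" for n
  proof -
    have "v n \<ge> 0" by (simp add: v_def ip_def)
    then have "v n = \<bar>v n\<bar>" by simp
    also have "\<dots> = \<bar>(nabla (L / real n) ^^ (2 * p)) K11 (- real p * (L / real n))\<bar>"
      unfolding v_eq by (simp add: abs_mult)
    finally show ?thesis by simp
  qed
  obtain \<kappa> where \<kappa>: "\<kappa> > 0"
    and v: "eventually (\<lambda>n. \<kappa> * (L / real n) powr (\<alpha>11 - 2 * real p) \<le> v n) sequentially"
    using condition_A_nabla_lower_bound[OF K11(1) L K11(2) p] unfolding v_abs by auto
  have lb11: "lag_bound K11 L p \<alpha>11"
    using K11(1) L p0 p by (intro condition_A_nabla_bound) auto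
  \<comment> \<open>The minimum keeps the exponent below 2 p however large \<alpha>22 is, and
    \<open>\<alpha>11 + min \<alpha>11 \<alpha>22\<close> still exceeds
    \<open>2 * \<alpha>11 - 1\<close> because \<alpha>11 < \<alpha>22 + 1.\<close>
  have lb22: "lag_bound K22 L p (min \<alpha>11 \<alpha>22)"
    using K22 L p0 p by (intro condition_A_nabla_bound) auto
  have \<rho>v: "(\<lambda>n. \<rho> n / v n) \<longlonglongrightarrow> 0"
  proof -
    obtain C where C: "C \<ge> 0 \<and> (\<forall>n m. 2 * p \<le> n \<longrightarrow> m + p \<le> n \<longrightarrow>
       \<bar>(nabla (L / real n) ^^ (2 * p)) K12 ((real m - real p) * (L / real n))\<bar> \<le>
         C * (real (m + 1) * (L / real n)) powr (a - 2 * real p))"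
      using K12(2) unfolding lag_bound_def by (rule exE)
    note C = C[THEN conjunct1] C[THEN conjunct2, rule_format]
    have "eventually (\<lambda>n. norm (\<rho> n / v n) \<le> C / \<kappa> * (L / real n) powr (a - \<alpha>11)) sequentially"
      using v eventually_ge_at_top[of "2 * p"]
    proof eventually_elim
      case (elim n)
      have h: "L / real n > 0" using L elim(2) p0 by auto
      have "\<bar>\<rho> n\<bar> \<le> C * (L / real n) powr (a - 2 * real p)"
      proof -
        have "\<bar>\<rho> n\<bar> = \<bar>(nabla (L / real n) ^^ (2 * p)) K12 ((real 0 - real p) * (L / real n))\<bar>"
          unfolding \<rho>_eq abs_mult by simp
        also have "\<dots> \<le> C * (real (0 + 1) * (L / real n)) powr (a - 2 * real p)"
          using elim(2) by (intro C(2)) auto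
        finally show ?thesis by simp
      qed
      moreover have "0 < \<kappa> * (L / real n) powr (\<alpha>11 - 2 * real p)"
        by (rule mult_pos_pos[OF \<kappa> powr_gt_zero[THEN iffD2, OF not_sym[OF less_imp_neq[OF h]]]])
      ultimately have "\<bar>\<rho> n\<bar> / v n \<le> C * (L / real n) powr (a - 2 * real p) /
          (\<kappa> * (L / real n) powr (\<alpha>11 - 2 * real p))"
        using C(1) elim(1) by (intro frac_le) auto
      also have "\<dots> = C / \<kappa> * ((L / real n) powr (a - 2 * real p) / (L / real n) powr (\<alpha>11 - 2 * real p))"
        by simp
      also have "(L / real n) powr (a - 2 * real p) / (L / real n) powr (\<alpha>11 - 2 * real p) =
          (L / real n) powr (a - \<alpha>11)"
        by (simp flip: powr_diff)
      finally show ?case using v_abs[of n] by (simp add: abs_divide)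
    qed
    moreover have "(\<lambda>n. C / \<kappa> * (L / real n) powr (a - \<alpha>11)) \<longlonglongrightarrow> C / \<kappa> * 0 powr (a - \<alpha>11)"
      using K12(1) L
      by (intro tendsto_intros tendsto_powr' lim_const_over_n) (auto intro!: always_eventually)
    then have "(\<lambda>n. C / \<kappa> * (L / real n) powr (a - \<alpha>11)) \<longlonglongrightarrow> 0" by simp
    ultimately show ?thesis by (rule Lim_null_comparison)
  qed
  have v_pos: "eventually (\<lambda>n. v n > 0) sequentially"
    using v eventually_gt_at_top[of 0]
  proof eventually_elim
    case (elim n)
    then have "0 < \<kappa> * (L / real n) powr (\<alpha>11 - 2 * real p)" using \<kappa> L by simp
    with elim show ?case by linarith
  qed
  let ?N = "\<lambda>n. real (n - p + 1)"
  let ?X = "\<lambda>n \<omega>. \<Sum>j\<le>n-p. U n j \<omega> * V n j \<omega> - \<rho> n"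
  let ?Y = "\<lambda>n \<omega>. \<Sum>j\<le>n-p. U n j \<omega> * U n j \<omega> - v n"
  have ipUV: "ip (U n j) (V n j) = \<rho> n" for n j
    using ip_grid_diff[of Z1 Z2 K12, OF H ip12] by (simp add: U_def V_def \<rho>_def)
  have ipUU: "ip (U n j) (U n j) = v n" for n j
    using ip_grid_diff[of Z1 Z1 K11, OF H(1) H(1) ip11] by (simp add: U_def v_def)
  have intX: "integrable M (\<lambda>\<omega>. (?X n \<omega>)\<^sup>2)" for n
    by (rule expectation_square_sum_mult(1)[of "{..n-p}" "U n" "V n"]) (rule finite_atMost UV ipUV)+
  have intY: "integrable M (\<lambda>\<omega>. (?Y n \<omega>)\<^sup>2)" for n
    by (rule expectation_square_sum_mult(1)[of "{..n-p}" "U n" "U n"]) (rule finite_atMost UV ipUU)+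
  have limX: "(\<lambda>n. expectation (\<lambda>\<omega>. (?X n \<omega>)\<^sup>2) / (?N n * v n)\<^sup>2) \<longlonglongrightarrow> 0"
    unfolding U_def V_def \<rho>_def
    by (rule square_sum_negligible[of Z1 Z2 K11 K22 K12 K21, OF H ip11 ip22 ip12 ip21 lb11 lb22 K12(2,3) L p0 p _ _ \<kappa> v])
       (use \<alpha>22 K12(1) in auto)
  have limY: "(\<lambda>n. expectation (\<lambda>\<omega>. (?Y n \<omega>)\<^sup>2) / (?N n * v n)\<^sup>2) \<longlonglongrightarrow> 0"
    unfolding U_def v_def
    by (rule square_sum_negligible[of Z1 Z1 K11 K11 K11 K11, OF H(1) H(1) ip11 ip11 ip11 ip11 lb11 lb11 lb11 lb11 L p0 p _ _ \<kappa>
          v[unfolded v_def U_def]]) auto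
  let ?A = "\<lambda>n \<omega>. (\<Sum>j\<le>n-p. U n j \<omega> * V n j \<omega>) / (?N n * v n)"
  let ?B = "\<lambda>n \<omega>. (\<Sum>j\<le>n-p. (U n j \<omega>)\<^sup>2) / (?N n * v n)"
  have sumX: "(\<Sum>j\<le>n-p. U n j \<omega> * V n j \<omega>) = ?X n \<omega> + ?N n * \<rho> n" for n \<omega>
    by (simp add: sum_subtractf)
  have sumY: "(\<Sum>j\<le>n-p. (U n j \<omega>)\<^sup>2) = ?Y n \<omega> + ?N n * v n" for n \<omega>
    by (simp add: sum_subtractf power2_eq_square)
  have measX: "?X n \<in> borel_measurable M" for n
    by (intro borel_measurable_sum borel_measurable_diff borel_measurable_times borel_measurable_const
        measurable_H[OF UV(1)] measurable_H[OF UV(2)])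
  have A_le: "(?A n \<omega>)\<^sup>2 \<le> 2 * ((?X n \<omega>)\<^sup>2 / (?N n * v n)\<^sup>2) + 2 * (\<rho> n / v n)\<^sup>2" for n \<omega>
  proof -
    have "?A n \<omega> = ?X n \<omega> / (?N n * v n) + \<rho> n / v n"
      unfolding sumX by (simp add: add_divide_distrib)
    moreover have sq: "(x + y)\<^sup>2 \<le> 2 * x\<^sup>2 + 2 * y\<^sup>2" for x y :: real
      using sum_squares_bound[of x y] by (simp add: power2_sum)
    ultimately show ?thesis
      using sq[of "?X n \<omega> / (?N n * v n)" "\<rho> n / v n"] by (simp only: power_divide)
  qed
  have intA_ub: "integrable M (\<lambda>\<omega>. 2 * ((?X n \<omega>)\<^sup>2 / (?N n * v n)\<^sup>2) + 2 * (\<rho> n / v n)\<^sup>2)" for n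
    using intX[of n] by simp
  have intA: "integrable M (\<lambda>\<omega>. (?A n \<omega>)\<^sup>2)" for n
  proof (rule Bochner_Integration.integrable_bound[OF intA_ub[of n]])
    show "(\<lambda>\<omega>. (?A n \<omega>)\<^sup>2) \<in> borel_measurable M"
      unfolding sumX using measX[of n] by measurable
    show "AE \<omega> in M. norm ((?A n \<omega>)\<^sup>2) \<le> norm (2 * ((?X n \<omega>)\<^sup>2 / (?N n * v n)\<^sup>2) + 2 * (\<rho> n / v n)\<^sup>2)"
      by (intro always_eventually allI) (use A_le in \<open>simp add: abs_of_nonneg\<close>)
  qed
  have limA: "(\<lambda>n. expectation (\<lambda>\<omega>. (?A n \<omega>)\<^sup>2)) \<longlonglongrightarrow> 0"
  proof (rule tendsto_sandwich[OF _ _ tendsto_const])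
    show "eventually (\<lambda>n. expectation (\<lambda>\<omega>. (?A n \<omega>)\<^sup>2) \<le>
        2 * (expectation (\<lambda>\<omega>. (?X n \<omega>)\<^sup>2) / (?N n * v n)\<^sup>2) + 2 * (\<rho> n / v n)\<^sup>2) sequentially"
    proof (intro always_eventually allI)
      fix n
      have "expectation (\<lambda>\<omega>. (?A n \<omega>)\<^sup>2) \<le>
          expectation (\<lambda>\<omega>. 2 * ((?X n \<omega>)\<^sup>2 / (?N n * v n)\<^sup>2) + 2 * (\<rho> n / v n)\<^sup>2)"
        by (intro integral_mono intA intA_ub A_le)
      also have "\<dots> = 2 * (expectation (\<lambda>\<omega>. (?X n \<omega>)\<^sup>2) / (?N n * v n)\<^sup>2) + 2 * (\<rho> n / v n)\<^sup>2"
        using intX[of n] by (simp add: prob_space)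
      finally show "expectation (\<lambda>\<omega>. (?A n \<omega>)\<^sup>2) \<le>
          2 * (expectation (\<lambda>\<omega>. (?X n \<omega>)\<^sup>2) / (?N n * v n)\<^sup>2) + 2 * (\<rho> n / v n)\<^sup>2" .
    qed
    have "(\<lambda>n. 2 * (expectation (\<lambda>\<omega>. (?X n \<omega>)\<^sup>2) / (?N n * v n)\<^sup>2) + 2 * (\<rho> n / v n)\<^sup>2) \<longlonglongrightarrow> 2 * 0 + 2 * 0\<^sup>2"
      by (intro tendsto_intros limX \<rho>v)
    then show "(\<lambda>n. 2 * (expectation (\<lambda>\<omega>. (?X n \<omega>)\<^sup>2) / (?N n * v n)\<^sup>2) + 2 * (\<rho> n / v n)\<^sup>2) \<longlonglongrightarrow> 0"
      by simp
  qed auto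
  \<comment> \<open>This needs \<open>v n > 0\<close>: for \<open>v n = 0\<close> division by zero
    makes \<open>?B n\<close> equal to 0, and the identity fails.\<close>
  have B_eq: "eventually (\<lambda>n. \<forall>\<omega>. (?B n \<omega> - 1)\<^sup>2 = (?Y n \<omega>)\<^sup>2 / (?N n * v n)\<^sup>2) sequentially"
    using v_pos
  proof eventually_elim
    case (elim n)
    have "?N n * v n \<noteq> 0" using elim by simp
    then have "?B n \<omega> - 1 = ?Y n \<omega> / (?N n * v n)" for \<omega>
      unfolding sumY by (simp add: add_divide_distrib)
    then show ?case by (simp add: power_divide)
  qed
  show ?thesis
  proof (rule tendsto_in_prob_ratio[OF T, where A = ?A and B = ?B])
    show "eventually (\<lambda>n. \<forall>\<omega>. ?B n \<omega> \<noteq> 0 \<longrightarrow> T n \<omega> - l = ?A n \<omega> / ?B n \<omega>) sequentially"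
      using ratio v_pos
    proof eventually_elim
      case (elim n)
      have "?N n * v n \<noteq> 0" using elim by simp
      then show ?case using elim(1) by (simp add: U_def V_def)
    qed
    show "eventually (\<lambda>n. integrable M (\<lambda>\<omega>. (?A n \<omega>)\<^sup>2)) sequentially"
      by (intro always_eventually allI intA)
    show "(\<lambda>n. expectation (\<lambda>\<omega>. (?A n \<omega>)\<^sup>2)) \<longlonglongrightarrow> 0" by (rule limA)
    show "eventually (\<lambda>n. integrable M (\<lambda>\<omega>. (?B n \<omega> - 1)\<^sup>2)) sequentially"
      using B_eq
    proof eventually_elim
      case (elim n)
      show ?case unfolding elim[rule_format] using intY[of n] by simp
    qed
    show "(\<lambda>n. expectation (\<lambda>\<omega>. (?B n \<omega> - 1)\<^sup>2)) \<longlonglongrightarrow> 0"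
      using limY
    proof (rule Lim_transform_eventually)
      show "eventually (\<lambda>n. expectation (\<lambda>\<omega>. (?Y n \<omega>)\<^sup>2) / (?N n * v n)\<^sup>2 =
          expectation (\<lambda>\<omega>. (?B n \<omega> - 1)\<^sup>2)) sequentially"
        using B_eq
      proof eventually_elim
        case (elim n)
        show ?case unfolding elim[rule_format] by simp
      qed
    qed
  qed
qed

end

section \<open>From the stationary field to a Gaussian space\<close>

lemma (in prob_space) normal_rv_integrable:
  assumes "normal_rv M Z"
  shows "integrable M Z"
proof (rule Bochner_Integration.integrable_bound)
  show "integrable M (\<lambda>\<omega>. 1 + Z \<omega> ^ 4)"
    using normal_rv_moments(1)[OF assms] by simp
  show "Z \<in> borel_measurable M" using assms by (simp add: normal_rv_def)
  have "\<bar>x\<bar> \<le> 1 + x ^ 4" for x :: real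
  proof (cases "\<bar>x\<bar> \<le> 1")
    case False
    then have "\<bar>x\<bar> ^ 1 \<le> \<bar>x\<bar> ^ 4" by (intro power_increasing) auto
    then show ?thesis by (simp add: power_even_abs)
  qed (simp add: add_increasing2)
  then show "AE \<omega> in M. norm (Z \<omega>) \<le> norm (1 + Z \<omega> ^ 4)"
    by (intro always_eventually allI) (simp add: abs_of_nonneg)
qed

lemma (in prob_space) gaussian_field_gaussian_space:
  fixes Z :: "real \<Rightarrow> 'a \<Rightarrow> real ^ 'n"
  assumes "gaussian_field M Z"
  shows "gaussian_space M
    {U. \<exists>F a c. finite F \<and> U = (\<lambda>\<omega>. (\<Sum>s\<in>F. a s \<bullet> Z s \<omega>) + c) \<and> expectation U = 0}"
    (is "gaussian_space M ?H")
proof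
  fix U assume "U \<in> ?H"
  then obtain F a c where F: "finite F" "U = (\<lambda>\<omega>. (\<Sum>s\<in>F. a s \<bullet> Z s \<omega>) + c)" by blast
  then show "normal_rv M U"
    using assms unfolding gaussian_field_def F(2) by (intro normal_rv_add_const) blast
next
  fix U assume "U \<in> ?H"
  then show "expectation U = 0" by blast
next
  fix U V a b assume "U \<in> ?H" "V \<in> ?H"
  then obtain F f c G g d where
    F: "finite F" "U = (\<lambda>\<omega>. (\<Sum>s\<in>F. f s \<bullet> Z s \<omega>) + c)" "expectation U = 0" and
    G: "finite G" "V = (\<lambda>\<omega>. (\<Sum>s\<in>G. g s \<bullet> Z s \<omega>) + d)" "expectation V = 0"
    by blast
  \<comment> \<open>Both coefficient families are extended by 0 to \<open>F \<union> G\<close>, so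
    that their combination is again one finite sum.\<close>
  let ?f = "\<lambda>s. a *\<^sub>R (if s \<in> F then f s else 0) + b *\<^sub>R (if s \<in> G then g s else 0)"
  have "normal_rv M U" "normal_rv M V"
    using assms F(1) G(1) unfolding gaussian_field_def F(2) G(2) by (intro normal_rv_add_const; blast)+
  then have E: "expectation (\<lambda>\<omega>. a * U \<omega> + b * V \<omega>) = 0"
    using F(3) G(3) normal_rv_integrable[of U] normal_rv_integrable[of V] by simp
  have "a * U \<omega> + b * V \<omega> = (\<Sum>s\<in>F \<union> G. ?f s \<bullet> Z s \<omega>) + (a * c + b * d)" for \<omega>
  proof -
    have "(\<Sum>s\<in>F. f s \<bullet> Z s \<omega>) = (\<Sum>s\<in>F \<union> G. (if s \<in> F then f s else 0) \<bullet> Z s \<omega>)"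
      using F(1) G(1) by (intro sum.mono_neutral_cong_left) auto
    moreover have "(\<Sum>s\<in>G. g s \<bullet> Z s \<omega>) = (\<Sum>s\<in>F \<union> G. (if s \<in> G then g s else 0) \<bullet> Z s \<omega>)"
      using F(1) G(1) by (intro sum.mono_neutral_cong_left) auto
    ultimately show ?thesis
      unfolding F(2) G(2) inner_add_left inner_scaleR_left sum.distrib sum_distrib_left[symmetric]
      by (simp only: distrib_left)
  qed
  then have eq: "(\<lambda>\<omega>. a * U \<omega> + b * V \<omega>) = (\<lambda>\<omega>. (\<Sum>s\<in>F \<union> G. ?f s \<bullet> Z s \<omega>) + (a * c + b * d))"
    by (rule ext)
  show "(\<lambda>\<omega>. a * U \<omega> + b * V \<omega>) \<in> ?H"
    by (intro CollectI exI conjI) (rule finite_UnI[OF F(1) G(1)], rule eq, rule E)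
qed

text \<open>This transfers condition A to the other cross-covariance, which is the reflected one.
  \<open>A\<close> and the derivatives \<open>D\<close> are kept; \<open>B\<close> is replaced by
  its reflection, because its evenness is only known on \<open>{-L..L}\<close> whereas the
  decomposition must hold everywhere.\<close>

lemma condition_A_reflect:
  assumes "condition_A f L c \<alpha>"
  shows "condition_A (\<lambda>t. f (- t)) L c \<alpha>"
proof -
  from assms obtain A B D where A: "real_analytic A" and obj:
      "\<alpha> > 0" "\<forall>m::nat. \<alpha> \<noteq> 2 * real m" "\<forall>t. f t = A t + B t" "\<forall>t. A (- t) = A t"
      "continuous_on {-L..L} B" "\<forall>t\<in>{-L..L}. B (- t) = B t" "\<forall>t\<in>{0<..L}. D 0 t = B t"
      "\<forall>k. \<forall>t\<in>{0<..L}. (D k has_real_derivative D (Suc k) t) (at t within {0<..L})"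
      "\<forall>k. (\<lambda>t. D k t - ffact \<alpha> k * c * t powr (\<alpha> - real k)) \<in> o[at_right 0](\<lambda>t. t powr (\<alpha> - real k))"
    unfolding condition_A_def by (elim conjE exE) (rule that; assumption)
  have "continuous_on {-L..L} (\<lambda>t. B (- t))"
    using obj(5) by (rule continuous_on_eq) (use obj(6) in auto)
  moreover have "\<forall>t. f (- t) = A t + B (- t)" "\<forall>t\<in>{-L..L}. B (- (- t)) = B (- t)"
      "\<forall>t\<in>{0<..L}. D 0 t = B (- t)"
    using obj by auto
  ultimately show ?thesis
    unfolding condition_A_def using A obj(1,2,4,8,9)
    by (intro conjI exI[of _ A] exI[of _ "\<lambda>t. B (- t)"] exI[of _ D])
qed

lemma lag_bound_zero: "lag_bound (\<lambda>_. 0) L p a"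
proof -
  have "(nabla h ^^ q) (\<lambda>_. 0) x = 0" for h q x
    using nabla_funpow_cmult[of q h 0 "\<lambda>_. 0"] by (simp add: fun_eq_iff)
  then show ?thesis unfolding lag_bound_def by (intro exI[of _ 0]) simp
qed

text \<open>Constants are polynomials of degree below \<open>p\<close>. This removes the unknown
  means of X and W from the estimator.\<close>

lemma nabla_funpow_add_const:
  assumes "p > 0" "h > 0"
  shows "(nabla h ^^ p) (\<lambda>s. f s + c) x = (nabla h ^^ p) f x"
proof -
  have "(nabla h ^^ p) (\<lambda>s. f s + c * s ^ 0) x = (nabla h ^^ p) f x"
    unfolding nabla_funpow_add nabla_funpow_cmult
    using nabla_funpow_pow_eq_0[OF assms] by simp
  then show ?thesis by simp
qed

section \<open>Measurability and locality of the estimator\<close>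

lemma borel_measurable_nabla_funpow:
  assumes "\<And>k. k \<le> q \<Longrightarrow> (\<lambda>\<omega>. f \<omega> (x + real k * h)) \<in> borel_measurable N"
  shows "(\<lambda>\<omega>. (nabla h ^^ q) (f \<omega>) x) \<in> borel_measurable N"
  using assms
proof (induction q arbitrary: x)
  case 0
  from "0.prems"[of 0] show ?case by simp
next
  case (Suc q)
  have "(\<lambda>\<omega>. (nabla h ^^ q) (f \<omega>) x) \<in> borel_measurable N"
    by (rule Suc.IH) (use Suc.prems in auto)
  moreover have "(\<lambda>\<omega>. (nabla h ^^ q) (f \<omega>) (x + h)) \<in> borel_measurable N"
  proof (rule Suc.IH)
    fix k assume "k \<le> q"
    moreover have "x + h + real k * h = x + real (Suc k) * h" by (simp add: algebra_simps)
    ultimately show "(\<lambda>\<omega>. f \<omega> (x + h + real k * h)) \<in> borel_measurable N"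
      using Suc.prems[of "Suc k"] by (simp only: Suc_le_mono)
  qed
  ultimately show ?case unfolding nabla_funpow_Suc by simp
qed

text \<open>For \<open>n < p\<close> the truncated \<open>n - p\<close> is 0 and the single term
  \<open>j = 0\<close> reads grid points up to index \<open>p\<close>; hence the maximum.\<close>

lemma borel_measurable_ols_slope:
  assumes "\<And>k. k \<le> max n p \<Longrightarrow> (\<lambda>\<omega>. x \<omega> (h * real k)) \<in> borel_measurable N"
    and "\<And>k. k \<le> max n p \<Longrightarrow> (\<lambda>\<omega>. y \<omega> (h * real k)) \<in> borel_measurable N"
  shows "(\<lambda>\<omega>. ols_slope p h n (x \<omega>) (y \<omega>)) \<in> borel_measurable N"
proof -
  have meas: "(\<lambda>\<omega>. (nabla h ^^ p) (f \<omega>) (h * real j)) \<in> borel_measurable N"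
    if "\<And>k. k \<le> max n p \<Longrightarrow> (\<lambda>\<omega>. f \<omega> (h * real k)) \<in> borel_measurable N" "j \<in> {0..n-p}" for f j
  proof (rule borel_measurable_nabla_funpow)
    fix k assume "k \<le> p"
    then have "j + k \<le> max n p" using that(2) by auto
    moreover have "h * real j + real k * h = h * real (j + k)" by (simp add: algebra_simps)
    ultimately show "(\<lambda>\<omega>. f \<omega> (h * real j + real k * h)) \<in> borel_measurable N"
      using that(1)[of "j + k"] by (simp only:)
  qed
  show ?thesis
    unfolding ols_slope_def
    by (intro borel_measurable_divide borel_measurable_sum borel_measurable_times borel_measurable_power meas assms)
qed

text \<open>For \<open>p \<le> n\<close> only grid indices up to \<open>n\<close> are read, so the
  estimator depends on the path over \<open>{0..L}\<close> alone.\<close>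

lemma ols_slope_cong:
  assumes "p \<le> n" "\<And>k. k \<le> n \<Longrightarrow> x (h * real k) = x' (h * real k)" "\<And>k. k \<le> n \<Longrightarrow> y (h * real k) = y' (h * real k)"
  shows "ols_slope p h n x y = ols_slope p h n x' y'"
proof -
  have eq: "(nabla h ^^ p) f (h * real j) = (nabla h ^^ p) g (h * real j)"
    if "\<And>k. k \<le> n \<Longrightarrow> f (h * real k) = g (h * real k)" "j \<in> {0..n-p}" for f g j
  proof (rule nabla_funpow_cong)
    fix k assume "k \<le> p"
    then have "j + k \<le> n" using that(2) assms(1) by auto
    moreover have "h * real j + real k * h = h * real (j + k)" by (simp add: algebra_simps)
    ultimately show "f (h * real j + real k * h) = g (h * real j + real k * h)"
      using that(1)[of "j + k"] by (simp only:)
  qed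
  have x: "(nabla h ^^ p) x (h * real j) = (nabla h ^^ p) x' (h * real j)"
    and y: "(nabla h ^^ p) y (h * real j) = (nabla h ^^ p) y' (h * real j)" if "j \<in> {0..n-p}" for j
    by (rule eq[OF _ that], erule assms)+
  show ?thesis
    unfolding ols_slope_def by (intro arg_cong2[where f = divide] sum.cong refl) (simp_all only: x y)
qed

section \<open>Consistency for the stationary field\<close>

lemma gaussian_field_components:
  fixes X W :: "real \<Rightarrow> 'a \<Rightarrow> real"
  assumes "gaussian_field M (\<lambda>s \<omega>. vector [X s \<omega>, W s \<omega>] :: real ^ 2)"
  shows "normal_rv M (X s)" "normal_rv M (W s)"
proof -
  have "normal_rv M (\<lambda>\<omega>. \<Sum>s\<in>{s}. a \<bullet> (vector [X s \<omega>, W s \<omega>] :: real ^ 2))" for a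
    using assms[unfolded gaussian_field_def, rule_format, of "{s}" "\<lambda>_. a"] by simp
  from this[of "axis 1 1"] this[of "axis 2 1"]
  show "normal_rv M (X s)" "normal_rv M (W s)" by (simp_all add: inner_axis')
qed

text \<open>\<open>T\<close> need only agree with the estimator eventually, which covers both the
  estimator itself and a functional of the restricted path that is altered for small
  \<open>n\<close>.\<close>

lemma stationary_ols_consistent:
  fixes X W :: "real \<Rightarrow> 'a \<Rightarrow> real" and K :: "real \<Rightarrow> real ^ 2 ^ 2"
  assumes "prob_space M"
    and field: "stationary_gaussian_field M (\<lambda>s \<omega>. vector [X s \<omega>, W s \<omega>] :: real ^ 2) K"
    and L: "L > 0"
    and K11: "condition_A (\<lambda>t. K t $ 1 $ 1) L c11 \<alpha>11" "c11 \<noteq> 0"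
    and K22: "condition_A (\<lambda>t. K t $ 2 $ 2) L c22 \<alpha>22"
    and \<alpha>22: "\<alpha>11 < \<alpha>22 + 1"
    and cross: "independent_processes M X W \<or>
         (\<exists>c12 \<alpha>12. condition_A (\<lambda>t. K t $ 1 $ 2) L c12 \<alpha>12 \<and> \<alpha>12 > \<alpha>11)"
    and p: "\<alpha>11 < 2 * real p"
    and T: "\<And>n. T n \<in> borel_measurable M"
    and T_eq: "eventually (\<lambda>n. \<forall>\<omega>. T n \<omega> =
        ols_slope p (L / real n) n (\<lambda>s. X s \<omega>) (\<lambda>s. X s \<omega> * \<beta> + W s \<omega>)) sequentially"
  shows "tendsto_in_prob M T \<beta>"
proof -
  interpret prob_space M by fact
  let ?Z = "\<lambda>s \<omega>. vector [X s \<omega>, W s \<omega>] :: real ^ 2"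
  let ?H = "{U. \<exists>F a c. finite F \<and> U = (\<lambda>\<omega>. (\<Sum>s\<in>F. a s \<bullet> ?Z s \<omega>) + c) \<and> expectation U = 0}"
  have gf: "gaussian_field M ?Z"
    and const: "\<And>k s s'. expectation (\<lambda>\<omega>. ?Z s \<omega> $ k) = expectation (\<lambda>\<omega>. ?Z s' \<omega> $ k)"
    and cov: "\<And>k l s t. covar M (\<lambda>\<omega>. ?Z (s + t) \<omega> $ k) (\<lambda>\<omega>. ?Z s \<omega> $ l) = K t $ k $ l"
    using field unfolding stationary_gaussian_field_def by blast+
  interpret gaussian_space M ?H by (rule gaussian_field_gaussian_space[OF gf])
  define mX mW where "mX = expectation (X 0)" and "mW = expectation (W 0)"
  have EX: "expectation (X s) = mX" and EW: "expectation (W s) = mW" for s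
    using const[of s 1 0] const[of s 2 0] by (simp_all add: mX_def mW_def)
  note nX = gaussian_field_components(1)[OF gf] and nW = gaussian_field_components(2)[OF gf]
  have intX: "integrable M (X s)" and intW: "integrable M (W s)" for s
    by (intro normal_rv_integrable nX nW)+
  define Z1 Z2 where "Z1 s = (\<lambda>\<omega>. X s \<omega> - mX)" and "Z2 s = (\<lambda>\<omega>. W s \<omega> - mW)" for s
  have Z1: "Z1 s \<in> ?H" for s
    unfolding Z1_def using intX[of s] EX[of s]
    by (intro CollectI exI[of _ "{s}"] exI[of _ "\<lambda>_. axis 1 1"] exI[of _ "- mX"]) (simp add: inner_axis' prob_space)
  have Z2: "Z2 s \<in> ?H" for s
    unfolding Z2_def using intW[of s] EW[of s]
    by (intro CollectI exI[of _ "{s}"] exI[of _ "\<lambda>_. axis 2 1"] exI[of _ "- mW"]) (simp add: inner_axis' prob_space)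
  have ips: "ip (Z1 s) (Z1 u) = K (s - u) $ 1 $ 1" "ip (Z2 s) (Z2 u) = K (s - u) $ 2 $ 2"
    "ip (Z1 s) (Z2 u) = K (s - u) $ 1 $ 2" "ip (Z2 s) (Z1 u) = K (s - u) $ 2 $ 1" for s u
    using cov[of u "s - u" 1 1] cov[of u "s - u" 2 2] cov[of u "s - u" 1 2] cov[of u "s - u" 2 1]
    by (simp_all add: ip_def Z1_def Z2_def covar_def EX EW)
  have K21: "K t $ 2 $ 1 = K (- t) $ 1 $ 2" for t
    using ips(4)[of t 0] ips(3)[of 0 t] ip_commute[of "Z1 0" "Z2 t"] by simp
  have \<alpha>0: "\<alpha>11 > 0" using K11(1) by (simp add: condition_A_def)
  then have p0: "p > 0" using p by (cases p) auto
  have "\<exists>a>\<alpha>11. lag_bound (\<lambda>t. K t $ 1 $ 2) L p a \<and> lag_bound (\<lambda>t. K t $ 2 $ 1) L p a"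
    using cross
  proof (elim disjE exE conjE)
    assume "independent_processes M X W"
    then have ind: "indep_var (Pi\<^sub>M UNIV (\<lambda>_. borel)) (\<lambda>\<omega> s. X s \<omega>) (Pi\<^sub>M UNIV (\<lambda>_. borel)) (\<lambda>\<omega> s. W s \<omega>)"
      by (simp add: independent_processes_def)
    have "K t $ 1 $ 2 = 0" for t
    proof -
      have "indep_var borel ((\<lambda>f. f t - mX) \<circ> (\<lambda>\<omega> s. X s \<omega>)) borel ((\<lambda>f. f 0 - mW) \<circ> (\<lambda>\<omega> s. W s \<omega>))"
        by (rule indep_var_compose[OF ind]) measurable
      then have "indep_var borel (Z1 t) borel (Z2 0)" by (simp add: o_def Z1_def Z2_def)
      then have "ip (Z1 t) (Z2 0) = expectation (Z1 t) * expectation (Z2 0)"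
        unfolding ip_def using intX intW
        by (intro indep_var_lebesgue_integral) (auto simp: Z1_def Z2_def)
      then show ?thesis using ips(3)[of t 0] mean_0[OF Z1] by simp
    qed
    \<comment> \<open>The cross-covariance vanishes, so any exponent above \<alpha>11 will
      do.\<close>
    then show ?thesis
      using lag_bound_zero by (intro exI[of _ "\<alpha>11 + 1"]) (simp add: K21)
  next
    fix c12 \<alpha>12 assume K12: "condition_A (\<lambda>t. K t $ 1 $ 2) L c12 \<alpha>12" and "\<alpha>11 < \<alpha>12"
    \<comment> \<open>Capping at 2 p meets the requirement of the lag bound and stays above
      \<alpha>11 because \<alpha>11 < 2 p.\<close>
    then show ?thesis
      using p L p0 condition_A_reflect[OF K12] unfolding K21
      by (intro exI[of _ "min \<alpha>12 (2 * real p)"] conjI condition_A_nabla_bound) auto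
  qed
  then obtain a where a: "\<alpha>11 < a" "lag_bound (\<lambda>t. K t $ 1 $ 2) L p a" "lag_bound (\<lambda>t. K t $ 2 $ 1) L p a"
    by blast
  have ratio: "eventually (\<lambda>n. \<forall>\<omega>. (\<Sum>j\<le>n-p. (grid_diff Z1 (L / real n) p j \<omega>)\<^sup>2) \<noteq> 0 \<longrightarrow>
        T n \<omega> - \<beta> = (\<Sum>j\<le>n-p. grid_diff Z1 (L / real n) p j \<omega> * grid_diff Z2 (L / real n) p j \<omega>) /
          (\<Sum>j\<le>n-p. (grid_diff Z1 (L / real n) p j \<omega>)\<^sup>2)) sequentially"
    using T_eq eventually_gt_at_top[of 0]
  proof eventually_elim
    case (elim n)
    let ?h = "L / real n"
    have h: "?h > 0" using elim L by simp
    have X: "(nabla ?h ^^ p) (\<lambda>s. X s \<omega>) (?h * real j) = grid_diff Z1 ?h p j \<omega>" for \<omega> j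
      using nabla_funpow_add_const[OF p0 h, of "\<lambda>s. Z1 s \<omega>" mX] by (simp add: grid_diff_def Z1_def)
    have W: "(nabla ?h ^^ p) (\<lambda>s. W s \<omega>) (?h * real j) = grid_diff Z2 ?h p j \<omega>" for \<omega> j
      using nabla_funpow_add_const[OF p0 h, of "\<lambda>s. Z2 s \<omega>" mW] by (simp add: grid_diff_def Z2_def)
    have Y: "(nabla ?h ^^ p) (\<lambda>s. X s \<omega> * \<beta> + W s \<omega>) (?h * real j) =
        \<beta> * grid_diff Z1 ?h p j \<omega> + grid_diff Z2 ?h p j \<omega>" for \<omega> j
      unfolding mult.commute[of _ \<beta>] nabla_funpow_add nabla_funpow_cmult X W ..
    show ?case
    proof (intro allI impI)
      fix \<omega>
      let ?S = "\<Sum>j\<le>n-p. (grid_diff Z1 ?h p j \<omega>)\<^sup>2"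
      let ?R = "\<Sum>j\<le>n-p. grid_diff Z1 ?h p j \<omega> * grid_diff Z2 ?h p j \<omega>"
      assume S: "?S \<noteq> 0"
      have "T n \<omega> = (\<beta> * ?S + ?R) / ?S"
        unfolding elim(1)[rule_format] ols_slope_def X Y atLeast0AtMost
        by (simp add: distrib_left sum.distrib sum_distrib_left power2_eq_square mult.left_commute)
      then show "T n \<omega> - \<beta> = ?R / ?S" using S by (simp add: add_divide_distrib)
    qed
  qed
  show "tendsto_in_prob M T \<beta>"
    by (rule difference_ratio_consistent[of Z1 Z2 "\<lambda>t. K t $ 1 $ 1" "\<lambda>t. K t $ 2 $ 2" "\<lambda>t. K t $ 1 $ 2"
        "\<lambda>t. K t $ 2 $ 1", OF Z1 Z2 ips K11 K22 a L p \<alpha>22 T ratio])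
qed

theorem theorem2:
  fixes M :: "'a measure"
    and X W Y :: "real \<Rightarrow> 'a \<Rightarrow> real"
    and K :: "real \<Rightarrow> real ^ 2 ^ 2"
    and \<beta> L c11 \<alpha>11 c22 \<alpha>22 :: real
  assumes "prob_space M"
    and "stationary_gaussian_field M (\<lambda>s \<omega>. vector [X s \<omega>, W s \<omega>] :: real ^ 2) K"
    and "\<And>s \<omega>. Y s \<omega> = X s \<omega> * \<beta> + W s \<omega>"
    and "L > 0"
    and "condition_A (\<lambda>t. K t $ 1 $ 1) L c11 \<alpha>11" and "c11 \<noteq> 0"
    and "condition_A (\<lambda>t. K t $ 2 $ 2) L c22 \<alpha>22" and "c22 \<noteq> 0"
    and "\<alpha>11 < \<alpha>22 + 1"
    and "independent_processes M X W \<or>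
         (\<exists>c12 \<alpha>12. condition_A (\<lambda>t. K t $ 1 $ 2) L c12 \<alpha>12 \<and> \<alpha>12 > \<alpha>11)"
  shows "slope_consistently_estimable M {0..L} X W \<and>
         (\<forall>p::nat. \<alpha>11 < 2 * real p \<longrightarrow>
            tendsto_in_prob M
              (\<lambda>n \<omega>. ols_slope p (L / real n) n (\<lambda>s. X s \<omega>) (\<lambda>s. Y s \<omega>)) \<beta>)"
proof (intro conjI allI impI)
  \<comment> \<open>The slope stays schematic: it becomes \<beta> for the least squares claim and an
    arbitrary \<open>b\<close> for estimability.\<close>
  note consistent = stationary_ols_consistent[OF assms(1,2,4,5,6,7,9,10)]
  obtain p :: nat where p: "\<alpha>11 / 2 < real p" using reals_Archimedean2 by blast
  then have p: "\<alpha>11 < 2 * real p" by simp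
  have "0 < \<alpha>11" using assms(5) by (simp add: condition_A_def)
  then have p0: "p > 0" using p by (cases p) auto
  have meas: "X s \<in> borel_measurable M" "W s \<in> borel_measurable M" for s
    using gaussian_field_components[of M X W s] assms(2)
    by (simp_all add: normal_rv_def stationary_gaussian_field_def)
  have measY: "(\<lambda>\<omega>. X s \<omega> * b + W s \<omega>) \<in> borel_measurable M" for s b
    by (intro borel_measurable_add borel_measurable_times meas borel_measurable_const)
  show "tendsto_in_prob M (\<lambda>n \<omega>. ols_slope q (L / real n) n (\<lambda>s. X s \<omega>) (\<lambda>s. Y s \<omega>)) \<beta>"
    if q: "\<alpha>11 < 2 * real q" for q
    unfolding assms(3)
    by (intro consistent[OF q] always_eventually allI refl borel_measurable_ols_slope meas measY)
  \<comment> \<open>The default 0 is needed for measurability on paths over \<open>{0..L}\<close>: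
    for \<open>0 < n < p\<close> the estimator would read points beyond \<open>L\<close>.\<close>
  define T :: "nat \<Rightarrow> (real \<Rightarrow> real \<times> real) \<Rightarrow> real" where
    "T n f = (if p \<le> n then ols_slope p (L / real n) n (\<lambda>s. fst (f s)) (\<lambda>s. snd (f s)) else 0)" for n f
  have grid: "L / real n * real k \<in> {0..L}" if "k \<le> n" "p \<le> n" for n k
  proof -
    have "n > 0" using that p0 by simp
    then have "L / real n * real k \<le> L / real n * real n"
      using that assms(4) by (intro mult_left_mono) auto
    then show ?thesis using \<open>n > 0\<close> assms(4) by auto
  qed
  have T_meas: "T n \<in> borel_measurable (Pi\<^sub>M {0..L} (\<lambda>_. borel))" for n
  proof (cases "p \<le> n")
    case True
    have comp: "(\<lambda>f. f (L / real n * real k)) \<in> measurable (Pi\<^sub>M {0..L} (\<lambda>_. borel)) (borel :: (real \<times> real) measure)"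
      if "k \<le> n" for k
      using grid[OF that True] by (rule measurable_component_singleton)
    have fst_snd: "fst \<in> borel_measurable (borel :: (real \<times> real) measure)" "snd \<in> borel_measurable (borel :: (real \<times> real) measure)"
      by (intro borel_measurable_continuous_onI continuous_intros)+
    have "(\<lambda>f. ols_slope p (L / real n) n (\<lambda>s. fst (f s)) (\<lambda>s. snd (f s))) \<in> borel_measurable (Pi\<^sub>M {0..L} (\<lambda>_. borel))"
      using True measurable_compose[OF comp fst_snd(1)] measurable_compose[OF comp fst_snd(2)]
      by (intro borel_measurable_ols_slope) simp_all
    moreover have "T n = (\<lambda>f. ols_slope p (L / real n) n (\<lambda>s. fst (f s)) (\<lambda>s. snd (f s)))"
      using True by (simp add: T_def fun_eq_iff)
    ultimately show ?thesis by simp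
  next
    case False
    then have "T n = (\<lambda>_. 0)" by (simp add: T_def fun_eq_iff)
    then show ?thesis by simp
  qed
  have "tendsto_in_prob M (\<lambda>n \<omega>. T n (\<lambda>s\<in>{0..L}. (X s \<omega>, X s \<omega> * b + W s \<omega>))) b" for b
  proof -
    have eq: "T n (\<lambda>s\<in>{0..L}. (X s \<omega>, X s \<omega> * b + W s \<omega>)) =
        ols_slope p (L / real n) n (\<lambda>s. X s \<omega>) (\<lambda>s. X s \<omega> * b + W s \<omega>)" if "p \<le> n" for n \<omega>
      unfolding T_def using that grid by (auto intro!: ols_slope_cong)
    show ?thesis
    proof (rule consistent[OF p])
      show "(\<lambda>\<omega>. T n (\<lambda>s\<in>{0..L}. (X s \<omega>, X s \<omega> * b + W s \<omega>))) \<in> borel_measurable M" for n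
      proof (cases "p \<le> n")
        case True
        then show ?thesis
          unfolding eq[OF True] by (intro borel_measurable_ols_slope meas measY)
      qed (simp add: T_def)
      show "eventually (\<lambda>n. \<forall>\<omega>. T n (\<lambda>s\<in>{0..L}. (X s \<omega>, X s \<omega> * b + W s \<omega>)) =
          ols_slope p (L / real n) n (\<lambda>s. X s \<omega>) (\<lambda>s. X s \<omega> * b + W s \<omega>)) sequentially"
        using eventually_ge_at_top[of p] by eventually_elim (simp add: eq)
    qed
  qed
  then show "slope_consistently_estimable M {0..L} X W"
    unfolding slope_consistently_estimable_def using T_meas by blast
qed

end
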